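(* Let $n\ge2$ and let $M=S^n$ be the unit sphere with the round metric. For $\varepsilon>0$ and $y\in M$ let $\gamma_\varepsilon$ be defined by $$\frac1{\gamma_\varepsilon}=k_n\int_M\frac{d(x,y)}{\varepsilon}\,K_\varepsilon(x,y)\,dx .$$ Then $\gamma_\varepsilon$ is independent of $y$ and converges as $\varepsilon\to0$, with positive limit $\gamma_{\mathrm{crit}}=\lim_{\varepsilon\to0}\gamma_\varepsilon=1$.
   Context: $d$ is the geodesic distance, $dx$ the Riemannian volume, and $\Delta$ the Laplace–Beltrami operator of the round metric. $K_\varepsilon:M\times M\to\mathbb{R}$ is the Helmholtz kernel, i.e. the unique distributional solution of $K_\varepsilon(\cdot,y)-\varepsilon^2\Delta K_\varepsilon(\cdot,y)=\delta_y$ in $M$ for each $y\in M$; it is smooth outside the diagonal. $\sigma_k$ is the $k$-dimensional volume of the Euclidean unit sphere $S^k\subset\mathbb{R}^{k+1}$ and $k_n=\frac{2}{n-1}\frac{\sigma_{n-2}}{\sigma_{n-1}}$. *)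

theory Defs
  imports "HOL-Analysis.Analysis"
begin

text \<open>
  The sphere \<open>S\<^sup>n\<close> is \<open>sphere 0 1\<close> in a Euclidean space \<open>'a\<close> with \<open>DIM('a) = n + 1\<close>,
  carrying the metric induced by the inner product of \<open>'a\<close>. Functions and vector fields on the
  sphere are functions on all of \<open>'a\<close> of which only the values on \<open>sphere 0 1\<close> matter.
\<close>

text \<open>
  Infimum of the lengths of piecewise \<open>C\<^sup>1\<close> curves in the sphere. \<^const>\<open>valid_path\<close> does not bound
  the derivative near the finitely many exceptional points, so finite length is part of the
  condition (\<^const>\<open>has_integral\<close> rather than \<^const>\<open>integral\<close>, which is 0 if the speed is not
  integrable).
\<close>
definition geodesic_dist :: "'a::euclidean_space \<Rightarrow> 'a \<Rightarrow> real" where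
  "geodesic_dist x y = Inf {L. \<exists>g. valid_path g \<and> path_image g \<subseteq> sphere 0 1 \<and>
      pathstart g = x \<and> pathfinish g = y \<and>
      ((\<lambda>t. norm (vector_derivative g (at t))) has_integral L) {0..1}}"

text \<open>
  The Riemannian volume of the unit sphere, as a measure on its Borel sets. In polar coordinates
  \<open>z = r x\<close>, with \<open>r > 0\<close> and \<open>x\<close> in the sphere, Lebesgue measure is \<open>dz = r\<^sup>n dr dx\<close>, where
  \<open>n + 1 = DIM('a)\<close>; hence \<open>A\<close> has volume \<open>n + 1\<close> times the Lebesgue measure of
  \<open>{r x | 0 < r < 1, x \<in> A}\<close>, which is the preimage of \<open>A\<close> under
  \<open>sgn z = z /\<^sub>R norm z\<close> in the punctured ball. If \<open>DIM('a) = 1\<close> this is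
  the counting measure on the two points of \<open>S\<^sup>0\<close>.
\<close>
definition sphere_volume :: "'a::euclidean_space measure" where
  "sphere_volume = scale_measure (of_nat DIM('a))
     (distr (restrict_space lborel (ball 0 1 - {0})) (restrict_space borel (sphere 0 1)) sgn)"

text \<open>The total volume \<open>\<sigma>\<^sub>k\<close> of \<open>S\<^sup>k\<close>, where \<open>DIM('a) = k + 1\<close>.\<close>
definition sphere_area :: "'a::euclidean_space itself \<Rightarrow> real" where
  "sphere_area _ = measure (sphere_volume :: 'a measure) (sphere 0 1)"

text \<open>\<open>Ck_on k U f\<close>: on the open set \<open>U\<close> the function \<open>f\<close> is \<open>k\<close> times continuously
  differentiable.\<close>
primrec Ck_on :: "nat \<Rightarrow> 'a::euclidean_space set \<Rightarrow> ('a \<Rightarrow> real) \<Rightarrow> bool" where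
  "Ck_on 0 U f \<longleftrightarrow> continuous_on U f"
| "Ck_on (Suc k) U f \<longleftrightarrow> (\<forall>x\<in>U. f differentiable (at x)) \<and>
     (\<forall>b\<in>Basis. Ck_on k U (\<lambda>x. frechet_derivative f (at x) b))"

definition smooth_on_sphere :: "('a::euclidean_space \<Rightarrow> real) \<Rightarrow> bool" where
  "smooth_on_sphere f \<longleftrightarrow> (\<exists>U F. open U \<and> sphere 0 1 \<subseteq> U \<and> (\<forall>k. Ck_on k U F) \<and>
     (\<forall>x\<in>sphere 0 1. F x = f x))"

text \<open>
  The Laplace--Beltrami operator \<open>div grad\<close>. Composition with \<open>sgn\<close> is the extension that is
  constant along rays. The ambient gradient of \<open>f \<circ> sgn\<close> at a point \<open>x\<close> of the sphere is therefore
  tangential and equals the Riemannian gradient of \<open>f\<close>. As the Levi-Civita connection is the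
  tangential part of the ambient derivative, the divergence of a tangent field \<open>X\<close> is the trace
  over the tangent space of the derivative of \<open>X\<close>; the derivative of \<open>X \<circ> sgn\<close> vanishes in the
  normal direction, so this is its trace over the whole of \<open>'a\<close>.
\<close>
definition sphere_grad :: "('a::euclidean_space \<Rightarrow> real) \<Rightarrow> 'a \<Rightarrow> 'a" where
  "sphere_grad f x = (\<Sum>b\<in>Basis. frechet_derivative (f \<circ> sgn) (at x) b *\<^sub>R b)"

definition sphere_div :: "('a::euclidean_space \<Rightarrow> 'a) \<Rightarrow> 'a \<Rightarrow> real" where
  "sphere_div X x = (\<Sum>b\<in>Basis. frechet_derivative (X \<circ> sgn) (at x) b \<bullet> b)"

definition sphere_laplacian :: "('a::euclidean_space \<Rightarrow> real) \<Rightarrow> 'a \<Rightarrow> real" where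
  "sphere_laplacian f = sphere_div (sphere_grad f)"

text \<open>
  \<open>K(\<cdot>,y) - \<epsilon>\<^sup>2 \<Delta> K(\<cdot>,y) = \<delta>\<^sub>y\<close> in the sense of distributions, for every \<open>y\<close> in the sphere. The
  distribution \<open>K(\<cdot>,y)\<close> is given by an integrable function, and \<open>\<Delta>\<close> is moved to the test function.
  The equation determines \<open>K(\<cdot>,y)\<close> up to null sets.
\<close>
definition helmholtz_kernel :: "real \<Rightarrow> ('a::euclidean_space \<Rightarrow> 'a \<Rightarrow> real) \<Rightarrow> bool" where
  "helmholtz_kernel \<epsilon> K \<longleftrightarrow> (\<forall>y\<in>sphere 0 1.
     integrable sphere_volume (\<lambda>x. K x y) \<and>
     (\<forall>f. smooth_on_sphere f \<longrightarrow>
        (\<integral>x. K x y * (f x - \<epsilon>\<^sup>2 * sphere_laplacian f x) \<partial>sphere_volume) = f y))"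

end

theory Submission
  imports Defs "HOL-Real_Asymp.Real_Asymp"
begin

text \<open>
  For polynomials \<open>p\<close> and \<open>s = 1 - x \<bullet> y\<close>, testing the equation of \<open>K(\<cdot>,y)\<close> with the zonal function
  \<open>p(s)\<close> gives \<open>\<Phi> (L p) = p(0)\<close>, where \<open>\<Phi> q\<close> is the integral of \<open>K(x,y) q(s)\<close> over \<open>x\<close> and
  \<open>L p = p - \<epsilon>\<^sup>2 (s (2 - s) p'' + n (1 - s) p')\<close>. As \<open>L\<close> is triangular with positive eigenvalues, it
  is onto; hence \<open>\<Phi>\<close> does not depend on \<open>y\<close>, and by the maximum principle and the Weierstrass theorem
  it is positive on \<open>C[0,2]\<close>. The moments \<open>F(a) = \<Phi> (s\<^sup>a)\<close> satisfy
  \<open>F(a) (1 + \<epsilon>\<^sup>2 a (a - 1 + n)) = \<epsilon>\<^sup>2 a (2 a - 2 + n) F(a - 1)\<close> and are log-convex in \<open>a\<close>. As in the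
  Bohr--Mollerup theorem this squeezes \<open>F(1/2) / \<epsilon>\<close>, and in the limit \<open>\<epsilon> \<rightarrow> 0\<close> yields the Gamma
  quotient that \<open>k\<^sub>n\<close> inverts. Finally \<open>d(x,y) = arccos (1 - s)\<close> differs from
  \<open>sqrt (2 s)\<close> by \<open>O(s)\<close>, and \<open>F(1) = O(\<epsilon>\<^sup>2)\<close>.
\<close>

section \<open>The Helmholtz operator on zonal polynomials\<close>

lemma weierstrass_poly:
  fixes f :: "real \<Rightarrow> real"
  assumes "continuous_on {a..b} f" "\<eta> > 0"
  obtains p :: "real poly" where "\<And>s. s \<in> {a..b} \<Longrightarrow> \<bar>f s - poly p s\<bar> < \<eta>"
proof -
  obtain g where g: "real_polynomial_function g" "\<And>x. x \<in> {a..b} \<Longrightarrow> \<bar>f x - g x\<bar> < \<eta>"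
    using Stone_Weierstrass_real_polynomial_function[of "{a..b}" f \<eta>] assms by auto
  then obtain c n where g_eq: "g = (\<lambda>x. \<Sum>i\<le>n. c i * x ^ i)"
    using real_polynomial_function_iff_sum by auto
  have "poly (\<Sum>i\<le>n. monom (c i) i) x = g x" for x
    by (simp add: g_eq poly_sum poly_monom)
  with g(2) show ?thesis
    using that by metis
qed

text \<open>The operator 1 - epsilon^2 Delta on S^n in the variable s = 1 - cos r, where r is the
  distance to the pole. As the pole lies at s = 0, a monomial in s is mapped to a combination of
  just two monomials.\<close>

definition helmholtz_op :: "real \<Rightarrow> real \<Rightarrow> real poly \<Rightarrow> real poly" where
  "helmholtz_op \<epsilon> n p =
     p - smult (\<epsilon>\<^sup>2) ([:0, 2, -1:] * pderiv (pderiv p) + smult n ([:1, -1:] * pderiv p))"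

lemma poly_helmholtz_op:
  "poly (helmholtz_op \<epsilon> n p) s =
     poly p s - \<epsilon>\<^sup>2 * (s * (2 - s) * poly (pderiv (pderiv p)) s + n * (1 - s) * poly (pderiv p) s)"
  by (simp add: helmholtz_op_def algebra_simps)

lemma poly_eqI_poly: "(\<And>x::real. poly p x = poly q x) \<Longrightarrow> p = q"
  by (simp add: poly_eq_poly_eq_iff[symmetric] ext)

lemma helmholtz_op_add: "helmholtz_op \<epsilon> n (p + q) = helmholtz_op \<epsilon> n p + helmholtz_op \<epsilon> n q"
  by (intro poly_eqI_poly) (simp add: poly_helmholtz_op pderiv_add algebra_simps)

lemma helmholtz_op_smult: "helmholtz_op \<epsilon> n (smult c p) = smult c (helmholtz_op \<epsilon> n p)"
  by (intro poly_eqI_poly) (simp add: poly_helmholtz_op pderiv_smult algebra_simps)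

text \<open>With j = \<open>Suc k\<close>, the diagonal entry is 1 + epsilon^2 j (j + n - 1), where
  j (j + n - 1) is the eigenvalue of -Delta on spherical harmonics of degree j. Its positivity is
  what makes the triangular system solvable.\<close>

lemma helmholtz_op_monom:
  "helmholtz_op \<epsilon> n (monom 1 (Suc k)) =
     monom (1 + \<epsilon>\<^sup>2 * real (Suc k) * (real k + n)) (Suc k)
     - smult (\<epsilon>\<^sup>2 * real (Suc k) * (2 * real k + n)) (monom 1 k)"
proof (cases k)
  case 0
  then show ?thesis
    by (intro poly_eqI_poly) (simp add: poly_helmholtz_op pderiv_monom poly_monom algebra_simps)
next
  case (Suc m)
  show ?thesis unfolding Suc
    by (intro poly_eqI_poly) (simp add: poly_helmholtz_op pderiv_monom poly_monom algebra_simps power2_eq_square)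
qed

lemma helmholtz_op_surj:
  assumes "n > 0"
  obtains p where "helmholtz_op \<epsilon> n p = q"
proof -
  have mon: "\<exists>p. helmholtz_op \<epsilon> n p = monom 1 k" for k
  proof (induction k)
    case 0
    have "helmholtz_op \<epsilon> n (monom 1 0) = monom 1 0"
      by (simp add: helmholtz_op_def pderiv_monom)
    then show ?case ..
  next
    case (Suc k)
    then obtain p where p: "helmholtz_op \<epsilon> n p = monom 1 k" by blast
    define l where "l = 1 + \<epsilon>\<^sup>2 * real (Suc k) * (real k + n)"
    define c where "c = \<epsilon>\<^sup>2 * real (Suc k) * (2 * real k + n)"
    have "l > 0"
      using assms by (auto simp: l_def intro!: add_pos_nonneg mult_nonneg_nonneg)
    have "helmholtz_op \<epsilon> n (smult (1 / l) (monom 1 (Suc k) + smult c p)) = monom 1 (Suc k)"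
      unfolding helmholtz_op_smult helmholtz_op_add helmholtz_op_monom p l_def[symmetric] c_def[symmetric]
      using \<open>l > 0\<close> by (simp add: smult_monom)
    then show ?case ..
  qed
  then obtain P where P: "\<And>k. helmholtz_op \<epsilon> n (P k) = monom 1 k"
    by metis
  have "helmholtz_op \<epsilon> n (\<Sum>k\<in>A. smult (coeff q k) (P k)) = (\<Sum>k\<in>A. monom (coeff q k) k)"
    if "finite A" for A
    \<comment> \<open>The instance of \<open>helmholtz_op_smult\<close> with zero arguments says
      that 0 is mapped to 0, which settles the empty sum.\<close>
    using that
    by induction (simp_all add: helmholtz_op_add helmholtz_op_smult P smult_monom
        helmholtz_op_smult[of _ _ 0 0, simplified])
  from this[of "{..degree q}"] show ?thesis
    using that by (simp add: poly_as_sum_of_monoms)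
qed

text \<open>If p'' were negative at s, then p' would be negative just to the right of s and p would
  drop below its minimum.\<close>

lemma poly_second_deriv_at_min:
  fixes p :: "real poly"
  assumes s: "a < s" "s < b" and min: "\<And>x. x \<in> {a..b} \<Longrightarrow> poly p s \<le> poly p x"
  shows "poly (pderiv p) s = 0" "poly (pderiv (pderiv p)) s \<ge> 0"
proof -
  show d0: "poly (pderiv p) s = 0"
  proof (rule DERIV_local_min[OF poly_DERIV])
    show "0 < min (s - a) (b - s)" using s by simp
    show "\<forall>y. \<bar>s - y\<bar> < min (s - a) (b - s) \<longrightarrow> poly p s \<le> poly p y"
      using min by (auto simp: abs_less_iff)
  qed
  show "poly (pderiv (pderiv p)) s \<ge> 0"
  proof (rule ccontr)
    assume "\<not> poly (pderiv (pderiv p)) s \<ge> 0"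
    then obtain d where d: "d > 0" "\<And>h. 0 < h \<Longrightarrow> h < d \<Longrightarrow> poly (pderiv p) (s + h) < 0"
      using DERIV_neg_dec_right[OF poly_DERIV, of "pderiv p" s] d0 by auto
    define h where "h = min (d / 2) (b - s)"
    have h: "0 < h" "h < d" "s + h \<le> b" using d s by (auto simp: h_def)
    obtain z where z: "s < z" "z < s + h" "poly p (s + h) - poly p s = h * poly (pderiv p) z"
      using MVT2[of s "s + h" "poly p" "poly (pderiv p)"] h poly_DERIV by auto
    have "poly (pderiv p) (s + (z - s)) < 0" using z h by (intro d) auto
    then have "h * poly (pderiv p) z < 0" using h by (simp add: mult_pos_neg)
    then show False using z min[of "s + h"] h s by auto
  qed
qed

text \<open>At a minimum point s of p on [0,2] the Laplacian term is nonnegative, so p(s) is at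
  least the value of the operator there. At the endpoints the second-order coefficient s (2 - s)
  vanishes and the first-order one points into the interval, so the sign of a one-sided derivative
  suffices.\<close>

lemma helmholtz_maximum_principle:
  assumes "n \<ge> 0" and nonneg: "\<And>s. s \<in> {0..2} \<Longrightarrow> poly (helmholtz_op \<epsilon> n p) s \<ge> 0"
  shows "poly p 0 \<ge> 0"
proof -
  have "compact {0..2::real}" "{0..2::real} \<noteq> {}" "continuous_on {0..2} (poly p)"
    by (auto intro: continuous_intros)
  from continuous_attains_inf[OF this]
  obtain s where s: "s \<in> {0..2}" and min: "\<And>x. x \<in> {0..2} \<Longrightarrow> poly p s \<le> poly p x" by auto
  have "s * (2 - s) * poly (pderiv (pderiv p)) s + n * (1 - s) * poly (pderiv p) s \<ge> 0"
  proof -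
    consider "s = 0" | "s = 2" | "0 < s" "s < 2" using s by fastforce
    then show ?thesis
    proof cases
      case 1
      have "poly (pderiv p) 0 \<ge> 0"
      proof (rule ccontr)
        assume "\<not> ?thesis"
        then obtain d where d: "d > 0" "\<And>h. 0 < h \<Longrightarrow> h < d \<Longrightarrow> poly p (0 + h) < poly p 0"
          using DERIV_neg_dec_right[OF poly_DERIV, of p 0] by auto
        show False using d(2)[of "min (d / 2) 2"] d(1) min[of "min (d / 2) 2"] 1 by (auto simp: min_less_iff_disj)
      qed
      then show ?thesis using 1 \<open>n \<ge> 0\<close> by simp
    next
      case 2
      have "poly (pderiv p) 2 \<le> 0"
      proof (rule ccontr)
        assume "\<not> ?thesis"
        then obtain d where d: "d > 0" "\<And>h. 0 < h \<Longrightarrow> h < d \<Longrightarrow> poly p (2 - h) < poly p 2"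
          using DERIV_pos_inc_left[OF poly_DERIV, of p 2] by auto
        show False using d(2)[of "min (d / 2) 2"] d(1) min[of "2 - min (d / 2) 2"] 2 by (auto simp: min_less_iff_disj)
      qed
      then show ?thesis using 2 \<open>n \<ge> 0\<close> by (simp add: mult_nonneg_nonpos)
    next
      case 3
      from poly_second_deriv_at_min[OF 3 min] show ?thesis using 3 by simp
    qed
  qed
  then have "\<epsilon>\<^sup>2 * (s * (2 - s) * poly (pderiv (pderiv p)) s + n * (1 - s) * poly (pderiv p) s) \<ge> 0"
    by simp
  with nonneg[OF s] have "poly p s \<ge> 0" by (simp add: poly_helmholtz_op)
  with min[of 0] show ?thesis by simp
qed

section \<open>Moments of a zonal functional\<close>

lemma poly_antiderivative:
  fixes w :: "real poly"
  obtains p where "pderiv p = w" "poly p 0 = 0"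
proof -
  define P where "P A = (\<Sum>k\<in>A. monom (coeff w k / real (Suc k)) (Suc k))" for A
  have "pderiv (P A) = (\<Sum>k\<in>A. monom (coeff w k) k)" if "finite A" for A
    using that
  proof induction
    case (insert k A)
    then show ?case
      by (simp add: P_def pderiv_add pderiv_monom del: of_nat_Suc)
  qed (simp add: P_def)
  from this[of "{..degree w}"] have "pderiv (P {..degree w}) = w"
    by (simp add: poly_as_sum_of_monoms)
  moreover have "poly (P {..degree w}) 0 = 0"
    by (simp add: P_def poly_sum poly_monom)
  ultimately show ?thesis using that by blast
qed

lemma continuous_on_powr_const:
  fixes a b :: real
  shows "a > 0 \<Longrightarrow> continuous_on {0..b} (\<lambda>s. s powr a)"
  by (rule continuous_on_powr') (auto intro: continuous_intros)

lemma mvt_real: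
  fixes f :: "real \<Rightarrow> real"
  assumes "a < b" "continuous_on {a..b} f"
    and "\<And>x. a < x \<Longrightarrow> x < b \<Longrightarrow> (f has_real_derivative f' x) (at x)"
  obtains x where "a < x" "x < b" "f b - f a = (b - a) * f' x"
  using mvt[of a b f "\<lambda>x. (*) (f' x)"] assms unfolding has_field_derivative_def
  by (metis mult.commute)

text \<open>
  The Euler operator \<open>p \<mapsto> (s p')'\<close> is inverted by two averages, so a uniform approximation of
  \<open>(s f')'\<close> controls \<open>f\<close>, \<open>f'\<close> and \<open>s f''\<close> although \<open>f''\<close> itself may be unbounded at \<open>0\<close>.
\<close>
lemma powr_euler_approximation:
  fixes a \<eta> :: real
  assumes a: "a > 1" and \<eta>: "\<eta> > 0"
  obtains p where "poly p 0 = 0"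
    and "\<And>s. s \<in> {0..2} \<Longrightarrow> \<bar>poly p s - s powr a\<bar> \<le> 2 * \<eta>"
    and "\<And>s. s \<in> {0..2} \<Longrightarrow> \<bar>poly (pderiv p) s - a * s powr (a - 1)\<bar> \<le> \<eta>"
    and "\<And>s. s \<in> {0..2} \<Longrightarrow> \<bar>s * poly (pderiv (pderiv p)) s - a * (a - 1) * s powr (a - 1)\<bar> \<le> 2 * \<eta>"
proof -
  \<comment> \<open>The approximated function is (s f')' for f = s^a.\<close>
  have "continuous_on {0..2} (\<lambda>s. a\<^sup>2 * s powr (a - 1))"
    using a by (intro continuous_intros continuous_on_powr_const) auto
  then obtain w where w: "\<And>s. s \<in> {0..2} \<Longrightarrow> \<bar>a\<^sup>2 * s powr (a - 1) - poly w s\<bar> < \<eta>"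
    using weierstrass_poly[OF _ \<eta>] by blast
  obtain W where W: "pderiv W = w" "poly W 0 = 0" by (rule poly_antiderivative)
  \<comment> \<open>\<open>pCons 0 v\<close> is s v(s); choosing p' = v turns W into s p', hence w
    into (s p')'.\<close>
  then obtain v where v: "W = pCons 0 v" by (cases W) auto
  obtain p where p: "pderiv p = v" "poly p 0 = 0" by (rule poly_antiderivative)
  have w_eq: "poly w s = poly (pderiv p) s + s * poly (pderiv (pderiv p)) s" for s
    by (simp add: W(1)[symmetric] v p(1) pderiv_pCons)
  have p': "\<bar>poly (pderiv p) s - a * s powr (a - 1)\<bar> \<le> \<eta>" if s: "s \<in> {0..2}" for s
  proof (cases "s = 0")
    case True
    then show ?thesis using w[OF s] w_eq[of 0] by simp
  next
    case False
    with s have "s > 0" by simp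
    \<comment> \<open>The mean value theorem for s p' - a s^a, whose derivative is the error of w,
      bounds s times the error of p' by s \<eta>, and s cancels.\<close>
    have "continuous_on {0..s} (\<lambda>x. x * poly (pderiv p) x - a * x powr a)"
      using a by (intro continuous_intros continuous_on_powr_const) auto
    moreover have "((\<lambda>x. x * poly (pderiv p) x - a * x powr a) has_real_derivative
        (poly w x - a\<^sup>2 * x powr (a - 1))) (at x)" if "x > 0" for x
      unfolding w_eq power2_eq_square using that
      by (auto intro!: derivative_eq_intros poly_DERIV)
    ultimately obtain x where x: "0 < x" "x < s"
      "s * poly (pderiv p) s - a * s powr a - (0 * poly (pderiv p) 0 - a * 0 powr a) =
        (s - 0) * (poly w x - a\<^sup>2 * x powr (a - 1))"
      by (rule mvt_real[OF \<open>s > 0\<close>])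
    have "s * (poly (pderiv p) s - a * s powr (a - 1)) = s * (poly w x - a\<^sup>2 * x powr (a - 1))"
      using x(3) \<open>s > 0\<close> a by (simp add: algebra_simps powr_mult_base)
    then show ?thesis using \<open>s > 0\<close> w[of x] x s by simp
  qed
  have p0: "\<bar>poly p s - s powr a\<bar> \<le> 2 * \<eta>" if s: "s \<in> {0..2}" for s
  proof (cases "s = 0")
    case True
    then show ?thesis using p \<eta> by simp
  next
    case False
    with s have "s > 0" by simp
    have "continuous_on {0..s} (\<lambda>x. poly p x - x powr a)"
      using a by (intro continuous_intros continuous_on_powr_const) auto
    moreover have "((\<lambda>x. poly p x - x powr a) has_real_derivative
        (poly (pderiv p) x - a * x powr (a - 1))) (at x)" if "x > 0" for x
      using that by (auto intro!: derivative_eq_intros poly_DERIV)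
    ultimately obtain x where x: "0 < x" "x < s"
      "poly p s - s powr a - (poly p 0 - 0 powr a) = (s - 0) * (poly (pderiv p) x - a * x powr (a - 1))"
      by (rule mvt_real[OF \<open>s > 0\<close>])
    have "\<bar>poly p s - s powr a\<bar> = s * \<bar>poly (pderiv p) x - a * x powr (a - 1)\<bar>"
      using x(3) p(2) a \<open>s > 0\<close> by (simp add: abs_mult)
    also have "\<dots> \<le> 2 * \<eta>"
      using p'[of x] x s by (intro mult_mono) auto
    finally show ?thesis .
  qed
  have "\<bar>s * poly (pderiv (pderiv p)) s - a * (a - 1) * s powr (a - 1)\<bar> \<le> 2 * \<eta>" if s: "s \<in> {0..2}" for s
    using w[OF s] p'[OF s] unfolding w_eq by (simp add: algebra_simps power2_eq_square)
  with p0 p' p(2) that show ?thesis by blast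
qed

lemma nonpos_if_le_mult_pos:
  fixes x c :: real
  assumes "c \<ge> 0" and le: "\<And>\<eta>. \<eta> > 0 \<Longrightarrow> x \<le> c * \<eta>"
  shows "x \<le> 0"
proof (rule field_le_epsilon)
  fix e :: real assume "e > 0"
  then have "x \<le> c * (e / (c + 1))" using assms by (intro le) auto
  also have "\<dots> \<le> (c + 1) * (e / (c + 1))" using assms \<open>e > 0\<close> by (intro mult_right_mono) auto
  finally show "x \<le> 0 + e" using assms(1) by simp
qed

text \<open>Abstracts the integral of K(x,y) q(1 - x.y) over x as a bounded functional of q in
  C[0,2]. \<open>repr\<close> is the Helmholtz equation tested with zonal polynomials. Positivity is
  not assumed; it is derived in \<open>nonneg\<close>.\<close>

locale zonal_functional =
  fixes \<epsilon> n C :: real and \<Phi> :: "(real \<Rightarrow> real) \<Rightarrow> real"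
  assumes eps_pos: "\<epsilon> > 0" and n_pos: "n > 0" and C_nonneg: "C \<ge> 0"
    and lin: "\<And>f g a b. continuous_on {0..2} f \<Longrightarrow> continuous_on {0..2} g \<Longrightarrow>
      \<Phi> (\<lambda>s. a * f s + b * g s) = a * \<Phi> f + b * \<Phi> g"
    and bound: "\<And>f B. continuous_on {0..2} f \<Longrightarrow> (\<And>s. s \<in> {0..2} \<Longrightarrow> \<bar>f s\<bar> \<le> B) \<Longrightarrow> \<bar>\<Phi> f\<bar> \<le> C * B"
    and repr: "\<And>p. \<Phi> (poly (helmholtz_op \<epsilon> n p)) = poly p 0"
begin

lemma diff: "continuous_on {0..2} f \<Longrightarrow> continuous_on {0..2} g \<Longrightarrow> \<Phi> (\<lambda>s. f s - g s) = \<Phi> f - \<Phi> g"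
  using lin[of f g 1 "-1"] by simp

lemma scale: "continuous_on {0..2} f \<Longrightarrow> \<Phi> (\<lambda>s. a * f s) = a * \<Phi> f"
  using lin[of f f a 0] by simp

lemma dist_le:
  assumes "continuous_on {0..2} f" "continuous_on {0..2} g"
    and "\<And>s. s \<in> {0..2} \<Longrightarrow> \<bar>f s - g s\<bar> \<le> B"
  shows "\<bar>\<Phi> f - \<Phi> g\<bar> \<le> C * B"
  using bound[of "\<lambda>s. f s - g s" B] assms by (simp add: diff continuous_on_diff)

text \<open>The bound with B = 0 shows that values outside [0,2] do not influence the
  functional.\<close>

lemma cong:
  assumes "continuous_on {0..2} f" "continuous_on {0..2} g" "\<And>s. s \<in> {0..2} \<Longrightarrow> f s = g s"
  shows "\<Phi> f = \<Phi> g"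
  using dist_le[of f g 0] assms by simp

text \<open>Surjectivity gives q = L p, the functional takes the value p(0) on q, and the maximum
  principle controls the sign of p(0).\<close>

lemma nonneg_poly:
  assumes "\<And>s. s \<in> {0..2} \<Longrightarrow> poly q s \<ge> 0"
  shows "\<Phi> (poly q) \<ge> 0"
proof -
  obtain p where p: "helmholtz_op \<epsilon> n p = q"
    using helmholtz_op_surj[OF n_pos] .
  then show ?thesis
    using helmholtz_maximum_principle[of n \<epsilon> p] assms n_pos repr[of p] by simp
qed

lemma nonneg:
  assumes cont: "continuous_on {0..2} f" and pos: "\<And>s. s \<in> {0..2} \<Longrightarrow> f s \<ge> 0"
  shows "\<Phi> f \<ge> 0"
proof -
  have "- \<Phi> f \<le> C * 2 * \<delta>" if "\<delta> > 0" for \<delta>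
  proof -
    \<comment> \<open>Approximating the shifted function to within the size of the shift yields a
      polynomial that is nonnegative on [0,2].\<close>
    have "continuous_on {0..2} (\<lambda>s. f s + \<delta>)" by (intro continuous_intros cont)
    then obtain p where p: "\<And>s. s \<in> {0..2} \<Longrightarrow> \<bar>f s + \<delta> - poly p s\<bar> < \<delta>"
      using weierstrass_poly[OF _ \<open>\<delta> > 0\<close>] by blast
    have "poly p s \<ge> 0" if "s \<in> {0..2}" for s using p[OF that] pos[OF that] by linarith
    then have "\<Phi> (poly p) \<ge> 0" by (rule nonneg_poly)
    moreover have "\<bar>f s - poly p s\<bar> \<le> 2 * \<delta>" if "s \<in> {0..2}" for s using p[OF that] by linarith
    then have "\<bar>\<Phi> f - \<Phi> (poly p)\<bar> \<le> C * (2 * \<delta>)"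
      by (intro dist_le cont continuous_intros)
    ultimately show ?thesis by (simp add: mult.assoc)
  qed
  then have "- \<Phi> f \<le> 0"
    using nonpos_if_le_mult_pos[of "C * 2" "- \<Phi> f"] C_nonneg by simp
  then show ?thesis by simp
qed

lemma mono:
  assumes "continuous_on {0..2} f" "continuous_on {0..2} g" "\<And>s. s \<in> {0..2} \<Longrightarrow> f s \<le> g s"
  shows "\<Phi> f \<le> \<Phi> g"
  using nonneg[of "\<lambda>s. g s - f s"] assms by (simp add: diff continuous_on_diff)

lemma cauchy_schwarz:
  assumes f: "continuous_on {0..2} f" and g: "continuous_on {0..2} g"
  shows "(\<Phi> (\<lambda>s. f s * g s))\<^sup>2 \<le> \<Phi> (\<lambda>s. (f s)\<^sup>2) * \<Phi> (\<lambda>s. (g s)\<^sup>2)"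
proof -
  define A where "A = \<Phi> (\<lambda>s. (f s)\<^sup>2)"
  define B where "B = \<Phi> (\<lambda>s. f s * g s)"
  define D where "D = \<Phi> (\<lambda>s. (g s)\<^sup>2)"
  have q: "a\<^sup>2 * A + 2 * a * b * B + b\<^sup>2 * D \<ge> 0" for a b
  proof -
    have cf: "continuous_on {0..2} (\<lambda>s. (f s)\<^sup>2)" "continuous_on {0..2} (\<lambda>s. f s * g s)"
       "continuous_on {0..2} (\<lambda>s. (g s)\<^sup>2)" "continuous_on {0..2} (\<lambda>s. 2 * a * b * (f s * g s) + b\<^sup>2 * (g s)\<^sup>2)"
      by (intro continuous_intros f g)+
    have "0 \<le> \<Phi> (\<lambda>s. (a * f s + b * g s)\<^sup>2)"
      by (intro nonneg continuous_intros f g) auto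
    also have "(\<lambda>s. (a * f s + b * g s)\<^sup>2) = (\<lambda>s. a\<^sup>2 * (f s)\<^sup>2 + 1 * (2 * a * b * (f s * g s) + b\<^sup>2 * (g s)\<^sup>2))"
      by (auto simp: power2_eq_square algebra_simps)
    also have "\<Phi> \<dots> = a\<^sup>2 * A + 2 * a * b * B + b\<^sup>2 * D"
      using lin[OF cf(1) cf(4), of "a\<^sup>2" 1] lin[OF cf(2) cf(3), of "2 * a * b" "b\<^sup>2"]
      by (simp add: A_def B_def D_def)
    finally show ?thesis .
  qed
  show ?thesis
  proof (cases "D = 0")
    case True
    have "B = 0"
    proof (rule ccontr)
      assume "B \<noteq> 0"
      \<comment> \<open>For D = 0 this choice gives the quadratic form the value -1.\<close>
      with q[of 1 "- (A + 1) / (2 * B)"] True show False by (simp add: field_simps)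
    qed
    with True show ?thesis by (simp add: B_def D_def)
  next
    case False
    have "D \<ge> 0" using q[of 0 1] by simp
    with False have "D > 0" by simp
    have "D * (A * D - B\<^sup>2) \<ge> 0"
      using q[of D "- B"] by (simp add: power2_eq_square algebra_simps)
    with \<open>D > 0\<close> have "A * D - B\<^sup>2 \<ge> 0" by (simp add: zero_le_mult_iff)
    then show ?thesis by (simp add: A_def B_def D_def)
  qed
qed

definition moment :: "real \<Rightarrow> real" where "moment a = \<Phi> (\<lambda>s. s powr a)"

text \<open>Formally this is \<open>repr\<close> for p = s^a, which vanishes at 0. As s^a need not
  be a polynomial, it is approximated so that the operator converges uniformly too. The condition a
  > 1 keeps s^(a - 1) continuous at 0.\<close>

lemma moment_step:
  assumes a: "a > 1"
  shows "moment a * (1 + \<epsilon>\<^sup>2 * a * (a - 1 + n)) = \<epsilon>\<^sup>2 * a * (2 * a - 2 + n) * moment (a - 1)"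
proof -
  define g where "g = (\<lambda>s::real. (1 + \<epsilon>\<^sup>2 * a * (a - 1 + n)) * s powr a +
     (- (\<epsilon>\<^sup>2 * a * (2 * a - 2 + n))) * s powr (a - 1))"
  have cont: "continuous_on {0..2::real} (\<lambda>s. s powr a)" "continuous_on {0..2::real} (\<lambda>s. s powr (a - 1))"
    using a by (auto intro!: continuous_on_powr_const)
  have cont_g: "continuous_on {0..2} g"
    unfolding g_def by (intro continuous_on_add continuous_on_mult_left cont)
  have "\<bar>\<Phi> g\<bar> \<le> C * (2 + \<epsilon>\<^sup>2 * (4 + n)) * \<eta>" if \<eta>: "\<eta> > 0" for \<eta>
  proof -
    obtain p where p: "poly p 0 = 0"
      "\<And>s. s \<in> {0..2} \<Longrightarrow> \<bar>poly p s - s powr a\<bar> \<le> 2 * \<eta>"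
      "\<And>s. s \<in> {0..2} \<Longrightarrow> \<bar>poly (pderiv p) s - a * s powr (a - 1)\<bar> \<le> \<eta>"
      "\<And>s. s \<in> {0..2} \<Longrightarrow> \<bar>s * poly (pderiv (pderiv p)) s - a * (a - 1) * s powr (a - 1)\<bar> \<le> 2 * \<eta>"
      using powr_euler_approximation[OF a \<eta>] by metis
    have "\<bar>g s - poly (helmholtz_op \<epsilon> n p) s\<bar> \<le> (2 + \<epsilon>\<^sup>2 * (4 + n)) * \<eta>" if s: "s \<in> {0..2}" for s
    proof -
      define e0 where "e0 = poly p s - s powr a"
      define e1 where "e1 = poly (pderiv p) s - a * s powr (a - 1)"
      define e2 where "e2 = s * poly (pderiv (pderiv p)) s - a * (a - 1) * s powr (a - 1)"
      have "s powr a = s * s powr (a - 1)"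
        using s by (simp add: powr_mult_base)
      \<comment> \<open>The second-order coefficient carries a factor s, so only the error of s p''
        enters, never that of p'' alone.\<close>
      then have "g s - poly (helmholtz_op \<epsilon> n p) s = - e0 + \<epsilon>\<^sup>2 * ((2 - s) * e2 + n * ((1 - s) * e1))"
        unfolding e0_def e1_def e2_def g_def poly_helmholtz_op by (simp add: algebra_simps)
      also have "\<bar>\<dots>\<bar> \<le> \<bar>e0\<bar> + \<epsilon>\<^sup>2 * (\<bar>2 - s\<bar> * \<bar>e2\<bar> + n * (\<bar>1 - s\<bar> * \<bar>e1\<bar>))"
        using n_pos by (intro order.trans[OF abs_triangle_ineq] add_mono)
          (auto simp: abs_mult intro!: mult_left_mono order.trans[OF abs_triangle_ineq])
      also have "\<dots> \<le> 2 * \<eta> + \<epsilon>\<^sup>2 * (2 * (2 * \<eta>) + n * (1 * \<eta>))"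
        using s n_pos p(2,3,4)[OF s] unfolding e0_def e1_def e2_def
        by (intro add_mono mult_left_mono mult_mono) auto
      also have "\<dots> = (2 + \<epsilon>\<^sup>2 * (4 + n)) * \<eta>" by (simp add: algebra_simps)
      finally show ?thesis .
    qed
    then have "\<bar>\<Phi> g - \<Phi> (poly (helmholtz_op \<epsilon> n p))\<bar> \<le> C * ((2 + \<epsilon>\<^sup>2 * (4 + n)) * \<eta>)"
      by (intro dist_le cont_g continuous_intros)
    then show ?thesis by (simp add: repr p(1) mult.assoc)
  qed
  then have "\<bar>\<Phi> g\<bar> \<le> 0"
    by (rule nonpos_if_le_mult_pos[rotated])
      (use C_nonneg n_pos in \<open>auto intro!: mult_nonneg_nonneg add_nonneg_nonneg\<close>)
  moreover have "\<Phi> g = (1 + \<epsilon>\<^sup>2 * a * (a - 1 + n)) * moment a + (- (\<epsilon>\<^sup>2 * a * (2 * a - 2 + n))) * moment (a - 1)"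
    unfolding g_def moment_def by (rule lin[OF cont])
  ultimately show ?thesis by (simp add: algebra_simps)
qed

text \<open>\<open>moment_step\<close> stops short of a = 1 because \<open>0 powr 0 = 0\<close>
  makes \<open>s powr 0\<close> discontinuous at 0. Here the equation is tested with the polynomials
  1 and s instead.\<close>

lemma moment_one: "moment 1 * (1 + \<epsilon>\<^sup>2 * n) = \<epsilon>\<^sup>2 * n"
proof -
  have "\<Phi> (poly (helmholtz_op \<epsilon> n 1)) = 1" by (simp add: repr)
  also have "poly (helmholtz_op \<epsilon> n 1) = (\<lambda>s. 1)" by (simp add: poly_helmholtz_op fun_eq_iff)
  finally have one: "\<Phi> (\<lambda>s. 1) = 1" .
  have "0 = \<Phi> (poly (helmholtz_op \<epsilon> n [:0, 1:]))" by (simp add: repr)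
  also have "poly (helmholtz_op \<epsilon> n [:0, 1:]) = (\<lambda>s. (1 + \<epsilon>\<^sup>2 * n) * s + (- (\<epsilon>\<^sup>2 * n)) * 1)"
    by (simp add: poly_helmholtz_op fun_eq_iff pderiv_pCons algebra_simps)
  also have "\<Phi> \<dots> = (1 + \<epsilon>\<^sup>2 * n) * \<Phi> (\<lambda>s. s) + (- (\<epsilon>\<^sup>2 * n)) * \<Phi> (\<lambda>s. 1)"
    by (intro lin continuous_intros)
  also have "\<Phi> (\<lambda>s. s) = moment 1"
    unfolding moment_def by (intro cong continuous_on_powr_const continuous_intros) auto
  finally show ?thesis by (simp add: one mult.commute)
qed

text \<open>Cauchy-Schwarz for the functions s^(a/2) and s^(b/2).\<close>

lemma moment_log_convex:
  assumes "a > 0" "b > 0"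
  shows "(moment ((a + b) / 2))\<^sup>2 \<le> moment a * moment b"
proof -
  have c: "continuous_on {0..2::real} (\<lambda>s. s powr a)" if "a > 0" for a
    using that by (rule continuous_on_powr_const)
  have eq: "s powr ((a + b) / 2) = s powr (a / 2) * s powr (b / 2)" for s :: real
    by (simp add: powr_add[symmetric] add_divide_distrib)
  have sq: "(s powr (a / 2))\<^sup>2 = s powr a" for a s :: real
    by (simp add: power2_eq_square powr_add[symmetric])
  show ?thesis
    using cauchy_schwarz[of "\<lambda>s. s powr (a / 2)" "\<lambda>s. s powr (b / 2)"] assms
    by (simp add: c moment_def eq sq)
qed

lemma moment_nonneg: "a > 0 \<Longrightarrow> moment a \<ge> 0"
  unfolding moment_def by (intro nonneg continuous_on_powr_const) auto

end

section \<open>The limit of the moment of order one half\<close>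

text \<open>By the recursion, \<epsilon>^2 \<open>rho\<close> is the factor from the moment of order
  a - 1 to that of order a. Splitting off \<epsilon>^2 leaves a factor with a finite limit as
  \<epsilon> tends to 0.\<close>

definition rho :: "real \<Rightarrow> real \<Rightarrow> real \<Rightarrow> real" where
  "rho \<epsilon> n a = a * (2 * a - 2 + n) / (1 + \<epsilon>\<^sup>2 * a * (a - 1 + n))"

text \<open>Compares the recursion along integer orders, starting at 1, with that along half-integer
  orders, starting at 3/2; the powers of \<epsilon> cancel.\<close>

definition rho_quot :: "real \<Rightarrow> real \<Rightarrow> nat \<Rightarrow> real" where
  "rho_quot \<epsilon> n k = (\<Prod>i<k. rho \<epsilon> n (real i + 1) / rho \<epsilon> n (real i + 3/2))"

lemma rho_denom_pos: "a \<ge> (1::real) \<Longrightarrow> n > 0 \<Longrightarrow> 1 + \<epsilon>\<^sup>2 * a * (a - 1 + n) > 0"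
  by (intro add_pos_nonneg mult_nonneg_nonneg) auto

lemma rho_pos: "a \<ge> 1 \<Longrightarrow> n > 0 \<Longrightarrow> rho \<epsilon> n a > 0"
  unfolding rho_def by (intro divide_pos_pos rho_denom_pos mult_pos_pos) auto

lemma tendsto_rho: "((\<lambda>\<epsilon>. rho \<epsilon> n a) \<longlongrightarrow> rho 0 n a) (at 0)"
  unfolding rho_def by (rule tendsto_eq_intros refl | simp)+

lemma tendsto_rho_quot:
  assumes "n > 0"
  shows "((\<lambda>\<epsilon>. rho_quot \<epsilon> n k) \<longlongrightarrow> rho_quot 0 n k) (at 0)"
  unfolding rho_quot_def using rho_pos[OF _ assms, of _ 0]
  by (intro tendsto_prod tendsto_divide tendsto_rho) (simp add: less_imp_neq[symmetric])

text \<open>At \<epsilon> = 0 the factors are linear in i, so the products are Pochhammer symbols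
  with parameters 1, n/2 over 3/2, (n+1)/2. Gauss's limit for Gamma applies to each. The lower
  parameters exceed the upper ones by 1 in total, whence the factor k.\<close>

lemma rho_quot_zero_limit:
  assumes n: "n > 0"
  shows "(\<lambda>k. real k * rho_quot 0 n k) \<longlonglongrightarrow> Gamma (3/2) * Gamma ((n + 1) / 2) / Gamma (n / 2)"
proof -
  have nonpos: "z \<notin> \<int>\<^sub>\<le>\<^sub>0" if "z > 0" for z :: real
    using that by (auto elim!: nonpos_Ints_cases)
  have lim: "Gamma_series' z \<longlonglongrightarrow> Gamma z" if "z > 0" for z :: real
    using Gamma_series'_LIMSEQ nonpos[OF that] by blast
  have quot: "rho_quot 0 n k = pochhammer 1 k * pochhammer (n / 2) k /
      (pochhammer (3 / 2) k * pochhammer ((n + 1) / 2) k)" for k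
    unfolding rho_quot_def rho_def pochhammer_prod prod.distrib[symmetric] prod_dividef[symmetric]
      atLeast0LessThan using n
    by (intro prod.cong) (auto simp: field_simps)
  have eq: "Gamma_series' (3/2) k * Gamma_series' ((n + 1) / 2) k /
      (Gamma_series' 1 k * Gamma_series' (n / 2) k) = real k * rho_quot 0 n k" if "k > 0" for k
  proof -
    have "exp (3/2 * ln (real k)) * exp ((n + 1) / 2 * ln (real k)) =
        real k * (exp (1 * ln (real k)) * exp (n / 2 * ln (real k)))"
    proof -
      have "3/2 * ln (real k) + (n + 1) / 2 * ln (real k) = ln (real k) + (1 * ln (real k) + n / 2 * ln (real k))"
        by (simp add: field_simps)
      then show ?thesis
        using that by (metis exp_add exp_ln of_nat_0_less_iff)
    qed
    moreover have "pochhammer z k > 0" if "z > 0" for z :: real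
      using that by (rule pochhammer_pos)
    then have "pochhammer (3/2) k \<noteq> (0::real)" "pochhammer ((n + 1) / 2) k \<noteq> 0"
      "pochhammer 1 k \<noteq> (0::real)" "pochhammer (n / 2) k \<noteq> 0"
      using n by (simp_all add: less_imp_neq[symmetric])
    ultimately show ?thesis
      by (simp add: Gamma_series'_def quot divide_simps)
  qed
  have "(\<lambda>k. Gamma_series' (3/2) k * Gamma_series' ((n + 1) / 2) k /
      (Gamma_series' 1 k * Gamma_series' (n / 2) k)) \<longlonglongrightarrow>
      Gamma (3/2) * Gamma ((n + 1) / 2) / (Gamma 1 * Gamma (n / 2))"
    using n Gamma_real_pos[of "n / 2"] by (intro tendsto_intros lim) (auto simp del: Gamma_real_pos)
  then show ?thesis
    by (rule Lim_transform_eventually[THEN tendsto_eq_rhs])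
      (use eq in \<open>auto intro!: eventually_sequentiallyI[of 1]\<close>)
qed

context zonal_functional
begin

lemma moment_rec:
  assumes "a > 1" shows "moment a = \<epsilon>\<^sup>2 * rho \<epsilon> n a * moment (a - 1)"
  using moment_step[OF assms] rho_denom_pos[of a n \<epsilon>] assms n_pos by (simp add: rho_def field_simps)

text \<open>The recursion at a = 1, with 1 in the place of the moment of order 0.\<close>

lemma moment_one_eq: "moment 1 = \<epsilon>\<^sup>2 * rho \<epsilon> n 1"
  using moment_one rho_denom_pos[of 1 n \<epsilon>] n_pos by (simp add: rho_def field_simps)

lemma moment_nat: "moment (real k + 1) = (\<Prod>i<Suc k. \<epsilon>\<^sup>2 * rho \<epsilon> n (real i + 1))"
proof (induction k)
  case 0
  then show ?case by (simp add: moment_one_eq)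
next
  case (Suc k)
  have "moment (real (Suc k) + 1) = \<epsilon>\<^sup>2 * rho \<epsilon> n (real (Suc k) + 1) * moment (real k + 1)"
    using moment_rec[of "real (Suc k) + 1"] by (simp add: add_ac)
  then show ?case unfolding Suc prod.lessThan_Suc[of _ "Suc k"] by (simp only: mult_ac)
qed

lemma moment_half: "moment (real k + 1/2) = (\<Prod>i<k. \<epsilon>\<^sup>2 * rho \<epsilon> n (real i + 3/2)) * moment (1/2)"
proof (induction k)
  case (Suc k)
  have "moment (real (Suc k) + 1/2) = \<epsilon>\<^sup>2 * rho \<epsilon> n (real k + 3/2) * moment (real k + 1/2)"
    using moment_rec[of "real k + 3/2"] by (simp add: add_ac)
  then show ?case unfolding Suc prod.lessThan_Suc by (simp only: mult_ac)
qed simp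

text \<open>Log-convexity at the orders k + 1/2, k + 1, k + 3/2 gives the lower bound, and at k + 1,
  k + 3/2, k + 2 the upper one. The recursion reduces the integer orders to known products and the
  half-integer ones to the moment of order 1/2.\<close>

lemma moment_half_bounds:
  shows "(rho_quot \<epsilon> n (Suc k))\<^sup>2 * rho \<epsilon> n (real k + 3/2) \<le> (moment (1/2) / \<epsilon>)\<^sup>2"
    and "(moment (1/2) / \<epsilon>)\<^sup>2 \<le> (rho_quot \<epsilon> n (Suc k))\<^sup>2 * rho \<epsilon> n (real k + 2)"
proof -
  define m where "m = moment (real k + 1)"
  define h where "h = (\<Prod>i<Suc k. \<epsilon>\<^sup>2 * rho \<epsilon> n (real i + 3/2))"
  have h: "h > 0" unfolding h_def
    using eps_pos n_pos by (intro prod_pos mult_pos_pos rho_pos ballI) auto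
  have q: "rho_quot \<epsilon> n (Suc k) = m / h"
    unfolding rho_quot_def m_def h_def moment_nat prod_dividef[symmetric] using eps_pos by simp
  have half: "moment (real k + 3/2) = h * moment (1/2)"
    using moment_half[of "Suc k"] by (simp add: h_def add_ac)
  have step: "moment (real k + 3/2) = \<epsilon>\<^sup>2 * rho \<epsilon> n (real k + 3/2) * moment (real k + 1/2)"
    "moment (real k + 2) = \<epsilon>\<^sup>2 * rho \<epsilon> n (real k + 2) * m"
    using moment_rec[of "real k + 3/2"] moment_rec[of "real k + 2"] by (simp_all add: m_def add_ac)
  have r: "rho \<epsilon> n (real k + 3/2) > 0" by (rule rho_pos) (use n_pos in auto)
  have mid: "(real k + 1/2 + (real k + 3/2)) / 2 = real k + 1" "(real k + 1 + (real k + 2)) / 2 = real k + 3/2"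
    by simp_all
  have "m\<^sup>2 \<le> moment (real k + 1/2) * moment (real k + 3/2)"
    using moment_log_convex[of "real k + 1/2" "real k + 3/2", unfolded mid] by (simp add: m_def)
  \<comment> \<open>The extra factor raises the order k + 1/2 to k + 3/2, so the right-hand side
    becomes a square.\<close>
  then have "m\<^sup>2 * (\<epsilon>\<^sup>2 * rho \<epsilon> n (real k + 3/2)) \<le>
      moment (real k + 1/2) * moment (real k + 3/2) * (\<epsilon>\<^sup>2 * rho \<epsilon> n (real k + 3/2))"
    using r by (intro mult_right_mono) auto
  also have "\<dots> = (h * moment (1/2))\<^sup>2" using step(1) half by (simp add: power2_eq_square mult_ac)
  finally show "(rho_quot \<epsilon> n (Suc k))\<^sup>2 * rho \<epsilon> n (real k + 3/2) \<le> (moment (1/2) / \<epsilon>)\<^sup>2"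
    using h eps_pos by (simp add: q field_simps)
  have "(moment (real k + 3/2))\<^sup>2 \<le> m * moment (real k + 2)"
    using moment_log_convex[of "real k + 1" "real k + 2", unfolded mid] by (simp add: m_def)
  then show "(moment (1/2) / \<epsilon>)\<^sup>2 \<le> (rho_quot \<epsilon> n (Suc k))\<^sup>2 * rho \<epsilon> n (real k + 2)"
    using h eps_pos unfolding half step(2) by (simp add: q field_simps power2_eq_square)
qed

end

text \<open>In the bounds \<epsilon> tends to 0 first, with k fixed, and k grows afterwards. Both
  limiting bounds tend to 2 G^2, so no uniformity in k is required.\<close>

lemma moment_half_limit:
  fixes \<Phi> :: "real \<Rightarrow> (real \<Rightarrow> real) \<Rightarrow> real"
  assumes n: "n > 0" and zf: "\<And>\<epsilon>. \<epsilon> > 0 \<Longrightarrow> zonal_functional \<epsilon> n (C \<epsilon>) (\<Phi> \<epsilon>)"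
  shows "((\<lambda>\<epsilon>. \<Phi> \<epsilon> sqrt / \<epsilon>) \<longlongrightarrow>
    sqrt 2 * Gamma (3/2) * Gamma ((n + 1) / 2) / Gamma (n / 2)) (at_right 0)"
proof -
  define G where "G = Gamma (3/2) * Gamma ((n + 1) / 2) / Gamma (n / 2)"
  define X where "X \<epsilon> = \<Phi> \<epsilon> (\<lambda>s. s powr (1/2)) / \<epsilon>" for \<epsilon>
  define q where "q = (\<lambda>\<epsilon> k. rho_quot \<epsilon> n (Suc k))"
  have b: "(q \<epsilon> k)\<^sup>2 * rho \<epsilon> n (real k + 3/2) \<le> (X \<epsilon>)\<^sup>2"
      "(X \<epsilon>)\<^sup>2 \<le> (q \<epsilon> k)\<^sup>2 * rho \<epsilon> n (real k + 2)" if "\<epsilon> > 0" for \<epsilon> k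
    using zonal_functional.moment_half_bounds[OF zf[OF that], of k]
    by (simp_all add: X_def q_def zonal_functional.moment_def[OF zf[OF that]])
  have lim: "((\<lambda>\<epsilon>. (q \<epsilon> k)\<^sup>2 * rho \<epsilon> n a) \<longlongrightarrow> (q 0 k)\<^sup>2 * rho 0 n a) (at_right 0)" for k a
    unfolding q_def
    by (rule tendsto_within_subset[where S = UNIV])
      (auto intro!: tendsto_mult tendsto_power tendsto_rho tendsto_rho_quot n)
  have q0: "(\<lambda>k. (q 0 k)\<^sup>2 * rho 0 n (real k + c)) \<longlonglongrightarrow> 2 * G\<^sup>2" for c
  proof -
    have "(\<lambda>k. (real (Suc k) * rho_quot 0 n (Suc k))\<^sup>2 *
        (rho 0 n (real k + c) / (real (Suc k))\<^sup>2)) \<longlonglongrightarrow> G\<^sup>2 * 2"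
    proof (intro tendsto_mult tendsto_power)
      show "(\<lambda>k. real (Suc k) * rho_quot 0 n (Suc k)) \<longlonglongrightarrow> G"
        unfolding G_def by (rule LIMSEQ_Suc[OF rho_quot_zero_limit[OF n]])
      show "(\<lambda>k. rho 0 n (real k + c) / (real (Suc k))\<^sup>2) \<longlonglongrightarrow> 2"
        unfolding rho_def by simp real_asymp
    qed
    then show ?thesis by (simp add: q_def power_mult_distrib mult.commute del: of_nat_Suc)
  qed
  have ev: "eventually (\<lambda>\<epsilon>::real. \<epsilon> > 0) (at_right 0)" by (simp add: eventually_at_right_less)
  have "((\<lambda>\<epsilon>. (X \<epsilon>)\<^sup>2) \<longlongrightarrow> 2 * G\<^sup>2) (at_right 0)"
  proof (rule order_tendstoI)
    fix l assume "l < 2 * G\<^sup>2"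
    then obtain k where "l < (q 0 k)\<^sup>2 * rho 0 n (real k + 3/2)"
      using order_tendstoD(1)[OF q0] eventually_happens'[OF sequentially_bot] by blast
    then have "eventually (\<lambda>\<epsilon>. l < (q \<epsilon> k)\<^sup>2 * rho \<epsilon> n (real k + 3/2)) (at_right 0)"
      by (rule order_tendstoD(1)[OF lim])
    with ev show "eventually (\<lambda>\<epsilon>. l < (X \<epsilon>)\<^sup>2) (at_right 0)"
      by eventually_elim (rule less_le_trans[OF _ b(1)])
  next
    fix l :: real assume "2 * G\<^sup>2 < l"
    then obtain k where "(q 0 k)\<^sup>2 * rho 0 n (real k + 2) < l"
      using order_tendstoD(2)[OF q0] eventually_happens'[OF sequentially_bot] by blast
    then have "eventually (\<lambda>\<epsilon>. (q \<epsilon> k)\<^sup>2 * rho \<epsilon> n (real k + 2) < l) (at_right 0)"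
      by (rule order_tendstoD(2)[OF lim])
    with ev show "eventually (\<lambda>\<epsilon>. (X \<epsilon>)\<^sup>2 < l) (at_right 0)"
      by eventually_elim (rule le_less_trans[OF b(2)])
  qed
  then have lim_sqrt: "((\<lambda>\<epsilon>. sqrt ((X \<epsilon>)\<^sup>2)) \<longlongrightarrow> sqrt (2 * G\<^sup>2)) (at_right 0)"
    by (rule tendsto_real_sqrt)
  have sqrt_G: "sqrt (2 * G\<^sup>2) = sqrt 2 * G"
    using n by (simp add: real_sqrt_mult G_def)
  have "eventually (\<lambda>\<epsilon>. sqrt ((X \<epsilon>)\<^sup>2) = \<Phi> \<epsilon> sqrt / \<epsilon>) (at_right 0)"
    using ev
  proof eventually_elim
    case (elim \<epsilon>)
    interpret zonal_functional \<epsilon> n "C \<epsilon>" "\<Phi> \<epsilon>" by (rule zf[OF elim])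
    have "X \<epsilon> \<ge> 0" using moment_nonneg[of "1/2"] elim by (simp add: X_def moment_def)
    moreover have "\<Phi> \<epsilon> (\<lambda>s. s powr (1/2)) = \<Phi> \<epsilon> sqrt"
      by (intro cong continuous_on_powr_const continuous_intros) (auto simp: powr_half_sqrt)
    ultimately show ?case using elim by (simp add: X_def zero_le_divide_iff)
  qed
  from Lim_transform_eventually[OF lim_sqrt this] show ?thesis
    by (simp only: sqrt_G) (simp add: G_def mult.assoc)
qed

section \<open>The geodesic distance\<close>

text \<open>
  The distance \<open>arccos (x \<bullet> z)\<close> to \<open>x\<close> is not differentiable at \<open>z = \<plusminus>x\<close>; for \<open>l < 1\<close> the function
  \<open>arccos (l * (x \<bullet> z))\<close> is a smooth substitute that still has gradient of norm at most 1.
\<close>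
lemma arccos_scaled_le_length:
  fixes x y :: "'a::euclidean_space"
  assumes l: "0 < l" "l < 1" and x: "norm x = 1" and g: "valid_path g" "path_image g \<subseteq> sphere 0 1"
    "pathstart g = x" "pathfinish g = y"
    and L: "((\<lambda>t. norm (vector_derivative g (at t))) has_integral L) {0..1}"
  shows "arccos (l * (x \<bullet> y)) - arccos l \<le> L"
proof -
  obtain S where S: "finite S" "continuous_on {0..1} g" "\<And>t. t \<in> {0..1} - S \<Longrightarrow> g differentiable (at t)"
    using g(1) unfolding valid_path_def piecewise_C1_differentiable_on_def C1_differentiable_on_eq
    by auto
  define h where "h t = g t \<bullet> x" for t
  define h' where "h' t = vector_derivative g (at t) \<bullet> x" for t
  have norm_g: "norm (g t) = 1" if "t \<in> {0..1}" for t
    using g(2) that by (auto simp: path_image_def image_subset_iff)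
  have h_le: "\<bar>h t\<bar> \<le> 1" if "t \<in> {0..1}" for t
    using Cauchy_Schwarz_ineq2[of "g t" x] norm_g[OF that] x by (simp add: h_def)
  have lh: "\<bar>l * h t\<bar> < 1" if "t \<in> {0..1}" for t
  proof -
    have "\<bar>l * h t\<bar> \<le> l" using h_le[OF that] l by (simp add: abs_mult mult_left_le)
    with l show ?thesis by linarith
  qed
  have int: "((\<lambda>t. - l * h' t / sqrt (1 - (l * h t)\<^sup>2)) has_integral
      (arccos (l * h 1) - arccos (l * h 0))) {0..1}"
  proof (rule fundamental_theorem_of_calculus_interior_strong[OF S(1)])
    show "continuous_on {0..1} (\<lambda>t. arccos (l * h t))"
      unfolding h_def using lh[unfolded h_def] by (intro continuous_intros S) (force simp: abs_le_iff abs_less_iff less_imp_le)+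
    fix t assume t: "t \<in> {0<..<1} - S"
    then have "(g has_vector_derivative vector_derivative g (at t)) (at t)"
      using S(3)[of t] by (auto simp: vector_derivative_works[symmetric])
    then have "(h has_real_derivative h' t) (at t)"
      unfolding h_def h'_def has_real_derivative_iff_has_vector_derivative
      by (rule bounded_linear.has_vector_derivative[OF bounded_linear_inner_left])
    moreover have "-1 < l * h t" "l * h t < 1" using lh[of t] t by auto
    ultimately have "((\<lambda>t. arccos (l * h t)) has_real_derivative (inverse (- sqrt (1 - (l * h t)\<^sup>2)) * (l * h' t))) (at t)"
      by (intro DERIV_chain'[where f = "\<lambda>t. l * h t" and g = arccos] DERIV_arccos DERIV_cmult) (auto intro: DERIV_cong)
    then show "((\<lambda>t. arccos (l * h t)) has_vector_derivative - l * h' t / sqrt (1 - (l * h t)\<^sup>2)) (at t)"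
      unfolding has_real_derivative_iff_has_vector_derivative[symmetric] by (simp add: field_simps)
  qed simp
  have bnd: "- l * h' t / sqrt (1 - (l * h t)\<^sup>2) \<le> norm (vector_derivative g (at t))" if t: "t \<in> {0<..<1} - S" for t
  proof -
    let ?v = "vector_derivative g (at t)"
    have tin: "t \<in> {0..1}" using t by auto
    have gd: "(g has_vector_derivative ?v) (at t)"
      using S(3)[of t] t by (auto simp: vector_derivative_works[symmetric])
    \<comment> \<open>A curve of constant norm has velocity orthogonal to its position. Hence only
      the tangential part of x, of length sqrt(1 - h^2), enters the derivative of h.\<close>
    have "((\<lambda>t. g t \<bullet> g t) has_vector_derivative (g t \<bullet> ?v + ?v \<bullet> g t)) (at t)"
      by (rule bounded_bilinear.has_vector_derivative[OF bounded_bilinear_inner gd gd])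
    moreover have "((\<lambda>t. g t \<bullet> g t) has_vector_derivative 0) (at t)"
    proof (rule has_vector_derivative_transform_within_open[of "\<lambda>_. 1" 0 t "{0<..<1}"])
      show "\<And>s. s \<in> {0<..<1} \<Longrightarrow> 1 = g s \<bullet> g s" using norm_g by (simp add: dot_square_norm)
    qed (use t in auto)
    ultimately have "g t \<bullet> ?v + ?v \<bullet> g t = 0" by (rule vector_derivative_unique_at)
    then have orth: "?v \<bullet> g t = 0" by (simp add: inner_commute)
    have "h' t = ?v \<bullet> (x - h t *\<^sub>R g t)" by (simp add: h'_def inner_diff_right orth)
    then have "\<bar>h' t\<bar> \<le> norm ?v * norm (x - h t *\<^sub>R g t)" using Cauchy_Schwarz_ineq2 by metis
    also have "norm (x - h t *\<^sub>R g t) = sqrt (1 - (h t)\<^sup>2)"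
      using x norm_g[OF tin]
      by (simp add: norm_eq_sqrt_inner inner_diff_left inner_diff_right h_def inner_commute power2_eq_square)
    finally have h': "\<bar>h' t\<bar> \<le> norm ?v * sqrt (1 - (h t)\<^sup>2)" .
    have "l\<^sup>2 * (1 - (h t)\<^sup>2) \<le> 1 - (l * h t)\<^sup>2"
      using l by (simp add: algebra_simps power_mult_distrib power_le_one)
    then have "sqrt (l\<^sup>2 * (1 - (h t)\<^sup>2)) \<le> sqrt (1 - (l * h t)\<^sup>2)"
      by (rule real_sqrt_le_mono)
    then have scaled: "l * sqrt (1 - (h t)\<^sup>2) \<le> sqrt (1 - (l * h t)\<^sup>2)"
      using l by (simp add: real_sqrt_mult)
    have "- h' t \<le> norm ?v * sqrt (1 - (h t)\<^sup>2)" using h' by linarith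
    then have "l * (- h' t) \<le> l * (norm ?v * sqrt (1 - (h t)\<^sup>2))"
      by (rule mult_left_mono) (use l in simp)
    also have "\<dots> = norm ?v * (l * sqrt (1 - (h t)\<^sup>2))" by (rule mult.left_commute)
    also have "\<dots> \<le> norm ?v * sqrt (1 - (l * h t)\<^sup>2)"
      by (rule mult_left_mono[OF scaled norm_ge_zero])
    finally have "- l * h' t \<le> norm ?v * sqrt (1 - (l * h t)\<^sup>2)" by simp
    moreover have "sqrt (1 - (l * h t)\<^sup>2) > 0"
      using lh[OF tin] by (simp add: abs_square_less_1)
    ultimately show ?thesis by (simp only: pos_divide_le_eq)
  qed
  have "arccos (l * h 1) - arccos (l * h 0) \<le> L"
  proof (rule has_integral_le)
    \<comment> \<open>The derivative bound is known only at interior points off S; altering the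
      integrand at finitely many points leaves its integral unchanged.\<close>
    let ?N = "S \<union> {0, 1}"
    let ?f = "\<lambda>t. if t \<in> ?N then 0 else - l * h' t / sqrt (1 - (l * h t)\<^sup>2)"
    show "(?f has_integral (arccos (l * h 1) - arccos (l * h 0))) {0..1}"
      by (rule has_integral_spike_finite[OF _ _ int, of ?N]) (use S in auto)
    show "?f t \<le> norm (vector_derivative g (at t))" if "t \<in> {0..1}" for t
      using bnd[of t] that by auto
  qed (rule L)
  moreover have "h 1 = x \<bullet> y" "h 0 = 1"
    using g(3,4) x by (auto simp: h_def pathstart_def pathfinish_def inner_commute dot_square_norm)
  ultimately show ?thesis by simp
qed

text \<open>Let l tend to 1 from below in \<open>arccos_scaled_le_length\<close>.\<close>

lemma arccos_le_length:
  fixes x y :: "'a::euclidean_space"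
  assumes x: "norm x = 1" and y: "norm y = 1"
    and g: "valid_path g" "path_image g \<subseteq> sphere 0 1" "pathstart g = x" "pathfinish g = y"
    and L: "((\<lambda>t. norm (vector_derivative g (at t))) has_integral L) {0..1}"
  shows "arccos (x \<bullet> y) \<le> L"
proof -
  have xy: "\<bar>x \<bullet> y\<bar> \<le> 1" using Cauchy_Schwarz_ineq2[of x y] x y by simp
  have "continuous_on {0..1} (\<lambda>l. arccos (l * (x \<bullet> y)) - arccos l)"
  proof (intro continuous_intros ballI)
    fix l :: real assume l: "l \<in> {0..1}"
    have "\<bar>l * (x \<bullet> y)\<bar> \<le> 1" using l xy by (auto simp: abs_mult intro: mult_le_one)
    then show "-1 \<le> l * (x \<bullet> y) \<and> l * (x \<bullet> y) \<le> 1" by auto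
  qed auto
  then have "((\<lambda>l. arccos (l * (x \<bullet> y)) - arccos l) \<longlongrightarrow> arccos (1 * (x \<bullet> y)) - arccos 1) (at 1 within {0..1})"
    unfolding continuous_on by (rule bspec) simp
  then have "((\<lambda>l. arccos (l * (x \<bullet> y)) - arccos l) \<longlongrightarrow> arccos (1 * (x \<bullet> y)) - arccos 1) (at_left 1)"
    by (simp add: at_within_Icc_at_left)
  moreover have "eventually (\<lambda>l. arccos (l * (x \<bullet> y)) - arccos l \<le> L) (at_left (1::real))"
    using eventually_at_left_real[of 0 "1::real", OF zero_less_one]
    by eventually_elim (use arccos_scaled_le_length[OF _ _ x g L] in auto)
  ultimately have "arccos (1 * (x \<bullet> y)) - arccos 1 \<le> L"
    by (intro tendsto_upperbound) auto
  then show ?thesis by simp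
qed

text \<open>The arc of a great circle from x to y, run at constant speed, attains the lower bound of
  \<open>arccos_le_length\<close>.\<close>

lemma geodesic_dist_eq_arccos:
  fixes x y :: "'a::euclidean_space"
  assumes dim: "DIM('a) \<ge> 2" and x: "norm x = 1" and y: "norm y = 1"
  shows "geodesic_dist x y = arccos (x \<bullet> y)"
proof -
  define \<theta> where "\<theta> = arccos (x \<bullet> y)"
  have xy: "\<bar>x \<bullet> y\<bar> \<le> 1" using Cauchy_Schwarz_ineq2[of x y] x y by simp
  have unit: "x \<bullet> x = 1" "y \<bullet> y = 1" using x y by (simp_all add: dot_square_norm)
  have cos: "cos \<theta> = x \<bullet> y" and \<theta>: "\<theta> \<ge> 0"
    using xy by (auto simp: \<theta>_def arccos_lbound)
  have sin: "sin \<theta> = sqrt (1 - (x \<bullet> y)\<^sup>2)" using xy by (simp add: \<theta>_def sin_arccos_abs)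
  obtain w where w: "norm w = 1" "x \<bullet> w = 0" "y = cos \<theta> *\<^sub>R x + sin \<theta> *\<^sub>R w"
  \<comment> \<open>If y is x or -x, any unit vector orthogonal to x may direct the arc; its
    existence needs dimension at least 2. Otherwise w is the normalized component of y orthogonal to
    x.\<close>
  proof (cases "sin \<theta> = 0")
    case True
    obtain v where v: "v \<noteq> 0" "orthogonal x v"
    proof -
      have "dim {x} \<le> 1" using dim_le_card'[of "{x}"] by simp
      then have "dim {x} < DIM('a)" using dim by simp
      then show thesis
        using that orthogonal_to_subspace_exists[of "{x}"] by (metis orthogonal_commute span_base insertI1)
    qed
    have "(norm (y - (x \<bullet> y) *\<^sub>R x))\<^sup>2 = 1 - (x \<bullet> y)\<^sup>2"
      unfolding power2_norm_eq_inner
      by (simp add: inner_diff_left inner_diff_right inner_commute power2_eq_square unit)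
    with True sin have "y = cos \<theta> *\<^sub>R x" by (simp add: cos)
    then show ?thesis
      using that[of "v /\<^sub>R norm v"] v True by (simp add: orthogonal_def)
  next
    case False
    define w where "w = (y - cos \<theta> *\<^sub>R x) /\<^sub>R sin \<theta>"
    have "(norm (y - (x \<bullet> y) *\<^sub>R x))\<^sup>2 = 1 - (x \<bullet> y)\<^sup>2"
      unfolding power2_norm_eq_inner
      by (simp add: inner_diff_left inner_diff_right inner_commute power2_eq_square unit)
    then have "norm (y - cos \<theta> *\<^sub>R x) = \<bar>sin \<theta>\<bar>"
      by (simp add: cos sin real_sqrt_unique)
    then have "norm w = 1" using False by (simp add: w_def)
    moreover have "x \<bullet> w = 0" using x by (simp add: w_def inner_diff_right cos dot_square_norm)
    moreover have "y = cos \<theta> *\<^sub>R x + sin \<theta> *\<^sub>R w" using False by (simp add: w_def)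
    ultimately show ?thesis by (rule that)
  qed
  define g where "g t = cos (\<theta> * t) *\<^sub>R x + sin (\<theta> * t) *\<^sub>R w" for t
  define g' where "g' t = (- \<theta> * sin (\<theta> * t)) *\<^sub>R x + (\<theta> * cos (\<theta> * t)) *\<^sub>R w" for t
  have nrm: "norm (a *\<^sub>R x + b *\<^sub>R w) = sqrt (a\<^sup>2 + b\<^sup>2)" for a b
  proof -
    have "w \<bullet> w = 1" "w \<bullet> x = 0" using w(1,2) by (simp_all add: dot_square_norm inner_commute)
    then show ?thesis
      unfolding norm_eq_sqrt_inner by (simp add: inner_add_left inner_add_right power2_eq_square unit w(2))
  qed
  have der: "(g has_vector_derivative g' t) (at t)" for t
    unfolding g_def g'_def has_vector_derivative_def
    by (auto intro!: derivative_eq_intros simp: algebra_simps)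
  have speed: "norm (vector_derivative g (at t)) = \<theta>" for t
  proof -
    have "vector_derivative g (at t) = g' t" by (rule vector_derivative_at[OF der])
    also have "norm \<dots> = sqrt (\<theta>\<^sup>2 * ((sin (\<theta> * t))\<^sup>2 + (cos (\<theta> * t))\<^sup>2))"
      unfolding g'_def nrm by (simp only: power_mult_distrib power2_minus distrib_left)
    finally show ?thesis using \<theta> by simp
  qed
  have "valid_path g"
  proof -
    have "continuous_on {0..1} g'" unfolding g'_def by (intro continuous_intros)
    then have "g C1_differentiable_on {0..1}"
      unfolding C1_differentiable_on_def using der by blast
    then show ?thesis
      unfolding valid_path_def by (rule C1_differentiable_imp_piecewise)
  qed
  moreover have "path_image g \<subseteq> sphere 0 1"
    unfolding path_image_def g_def by (auto simp: nrm)
  moreover have "pathstart g = x" "pathfinish g = y"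
    using w(3) by (simp_all add: g_def pathstart_def pathfinish_def)
  moreover have "((\<lambda>t. norm (vector_derivative g (at t))) has_integral \<theta>) {0..1}"
    unfolding speed using has_integral_const_real[of \<theta> 0 1] by simp
  ultimately have mem: "\<theta> \<in> {L. \<exists>g. valid_path g \<and> path_image g \<subseteq> sphere 0 1 \<and>
      pathstart g = x \<and> pathfinish g = y \<and>
      ((\<lambda>t. norm (vector_derivative g (at t))) has_integral L) {0..1}}"
    by blast
  then show ?thesis
    unfolding geodesic_dist_def \<theta>_def[symmetric]
    by (rule cInf_eq_minimum) (use arccos_le_length[OF x y] in \<open>auto simp: \<theta>_def\<close>)
qed

section \<open>The Laplacian of zonal functions\<close>

lemma has_derivative_sgn_sphere:
  fixes x :: "'a::euclidean_space"
  assumes "norm x = 1"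
  shows "(sgn has_derivative (\<lambda>h. h - (x \<bullet> h) *\<^sub>R x)) (at x)"
proof -
  have "x \<noteq> 0" using assms by auto
  then have "(norm has_derivative (\<lambda>h. x \<bullet> h)) (at x)"
    using has_derivative_norm[OF \<open>x \<noteq> 0\<close>] assms by (simp add: sgn_div_norm inner_commute[of _ x])
  then have "((\<lambda>z. inverse (norm z) *\<^sub>R z) has_derivative (\<lambda>h. h - (x \<bullet> h) *\<^sub>R x)) (at x)"
    using assms \<open>x \<noteq> 0\<close> by (auto intro!: derivative_eq_intros simp: inner_commute)
  then show ?thesis by (simp add: sgn_div_norm[abs_def])
qed

lemma has_derivative_poly_zonal:
  fixes x y :: "'a::euclidean_space" and p :: "real poly"
  shows "((\<lambda>x. poly p (1 - x \<bullet> y)) has_derivative (\<lambda>h. - poly (pderiv p) (1 - x \<bullet> y) * (h \<bullet> y))) (at x)"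
proof -
  have "((\<lambda>x. 1 - x \<bullet> y) has_derivative (\<lambda>h. - (h \<bullet> y))) (at x)"
    by (auto intro!: derivative_eq_intros)
  moreover have "(poly p has_derivative (\<lambda>h. poly (pderiv p) (1 - x \<bullet> y) * h)) (at (1 - x \<bullet> y))"
    using poly_DERIV[of p "1 - x \<bullet> y"] by (simp add: has_field_derivative_def)
  ultimately show ?thesis
    using diff_chain_at[of "\<lambda>x. 1 - x \<bullet> y" _ x "poly p"] by (fastforce simp: o_def)
qed

lemma sphere_grad_poly_zonal:
  fixes x y :: "'a::euclidean_space" and p :: "real poly"
  assumes "norm x = 1"
  shows "sphere_grad (\<lambda>x. poly p (1 - x \<bullet> y)) x = - poly (pderiv p) (1 - x \<bullet> y) *\<^sub>R (y - (x \<bullet> y) *\<^sub>R x)"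
proof -
  have sgn: "sgn x = x" using assms by (simp add: sgn_div_norm)
  let ?D = "\<lambda>h. - poly (pderiv p) (1 - x \<bullet> y) * ((h - (x \<bullet> h) *\<^sub>R x) \<bullet> y)"
  have "((\<lambda>x. poly p (1 - x \<bullet> y)) \<circ> sgn has_derivative ?D) (at x)"
    using diff_chain_at[OF has_derivative_sgn_sphere[OF assms] has_derivative_poly_zonal[of p y "sgn x"]]
    by (simp add: o_def sgn)
  then have "frechet_derivative ((\<lambda>x. poly p (1 - x \<bullet> y)) \<circ> sgn) (at x) = ?D"
    by (rule frechet_derivative_at[symmetric])
  then have "sphere_grad (\<lambda>x. poly p (1 - x \<bullet> y)) x =
      (\<Sum>b\<in>Basis. ((- poly (pderiv p) (1 - x \<bullet> y) *\<^sub>R (y - (x \<bullet> y) *\<^sub>R x)) \<bullet> b) *\<^sub>R b)"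
    unfolding sphere_grad_def
    by (intro sum.cong) (simp_all add: inner_diff_left inner_commute algebra_simps)
  then show ?thesis by (simp only: euclidean_representation)
qed

text \<open>The gradient is -p'(s) w, with w the tangential part of y. In the trace of its
  derivative, p'' is multiplied by the square of the length of w, which is s (2 - s), and p' by x.y
  times the dimension of the tangent space; the cross term vanishes as w is orthogonal to x.\<close>

lemma sphere_laplacian_poly_zonal:
  fixes x y :: "'a::euclidean_space" and p :: "real poly"
  assumes x: "norm x = 1" and y: "norm y = 1"
  defines "s \<equiv> 1 - x \<bullet> y"
  shows "sphere_laplacian (\<lambda>x. poly p (1 - x \<bullet> y)) x =
    s * (2 - s) * poly (pderiv (pderiv p)) s + (real DIM('a) - 1) * (1 - s) * poly (pderiv p) s"
proof -
  have sgn: "sgn x = x" and "x \<noteq> 0" using x by (auto simp: sgn_div_norm)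
  have unit: "x \<bullet> x = 1" "y \<bullet> y = 1" using x y by (simp_all add: dot_square_norm)
  define t where "t = x \<bullet> y"
  define w where "w = y - t *\<^sub>R x"
  let ?X = "sphere_grad (\<lambda>x. poly p (1 - x \<bullet> y))"
  define G where "G u = - poly (pderiv p) (1 - u \<bullet> y) *\<^sub>R (y - (u \<bullet> y) *\<^sub>R u)" for u
  define G' where "G' h = (poly (pderiv (pderiv p)) s * (h \<bullet> y)) *\<^sub>R w + poly (pderiv p) s *\<^sub>R ((h \<bullet> y) *\<^sub>R x + t *\<^sub>R h)" for h
  have G: "(G has_derivative G') (at x)"
    unfolding G_def G'_def
    by (rule has_derivative_eq_rhs, (rule derivative_intros has_derivative_poly_zonal)+)
      (simp add: fun_eq_iff algebra_simps s_def t_def w_def)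
  have "(G \<circ> sgn has_derivative G' \<circ> (\<lambda>h. h - (x \<bullet> h) *\<^sub>R x)) (at x)"
    using diff_chain_at[OF has_derivative_sgn_sphere[OF x], of G G'] G by (simp add: sgn)
  \<comment> \<open>The gradient formula holds on the sphere only, but after composition with
    \<open>sgn\<close> it holds on the open set of nonzero vectors, where derivatives may be
    compared.\<close>
  then have "(?X \<circ> sgn has_derivative G' \<circ> (\<lambda>h. h - (x \<bullet> h) *\<^sub>R x)) (at x)"
  proof (rule has_derivative_transform_within_open)
    show "open (- {0 :: 'a})" by (rule open_Compl) simp
    show "(G \<circ> sgn) z = (?X \<circ> sgn) z" if "z \<in> - {0}" for z
      using that sphere_grad_poly_zonal[of "sgn z" p y] by (simp add: G_def norm_sgn)
  qed (use \<open>x \<noteq> 0\<close> in auto)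
  then have "frechet_derivative (?X \<circ> sgn) (at x) = G' \<circ> (\<lambda>h. h - (x \<bullet> h) *\<^sub>R x)"
    by (rule frechet_derivative_at[symmetric])
  then have "sphere_laplacian (\<lambda>x. poly p (1 - x \<bullet> y)) x = (\<Sum>b\<in>Basis. G' (b - (x \<bullet> b) *\<^sub>R x) \<bullet> b)"
    by (simp add: sphere_laplacian_def sphere_div_def)
  also have "\<dots> = (\<Sum>b\<in>Basis. poly (pderiv (pderiv p)) s * ((w \<bullet> b) * (w \<bullet> b)) +
      poly (pderiv p) s * ((w \<bullet> b) * (x \<bullet> b)) + poly (pderiv p) s * (t * (1 - (x \<bullet> b) * (x \<bullet> b))))"
    by (intro sum.cong)
      (simp_all add: G'_def w_def inner_diff_left inner_add_left t_def inner_commute algebra_simps)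
  also have "\<dots> = poly (pderiv (pderiv p)) s * (w \<bullet> w) + poly (pderiv p) s * (w \<bullet> x) +
      poly (pderiv p) s * (t * (real DIM('a) - x \<bullet> x))"
    by (simp add: sum.distrib sum_distrib_left[symmetric] sum_subtractf euclidean_inner[symmetric])
  also have "w \<bullet> x = 0" by (simp add: w_def inner_diff_left unit t_def inner_commute[of y x])
  also have "w \<bullet> w = 1 - t\<^sup>2"
    by (simp add: w_def inner_diff_left inner_diff_right unit t_def inner_commute power2_eq_square)
  finally show ?thesis by (simp add: unit s_def t_def power2_eq_square algebra_simps)
qed

text \<open>Partial derivatives of zonal polynomials are again zonal polynomials with the same pole,
  so the induction runs over all p at once.\<close>

lemma smooth_on_sphere_poly_zonal:
  fixes y :: "'a::euclidean_space" and p :: "real poly"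
  shows "smooth_on_sphere (\<lambda>x. poly p (1 - x \<bullet> y))"
proof -
  have "Ck_on k UNIV (\<lambda>x. poly p (1 - x \<bullet> y))" for k
  proof (induction k arbitrary: p)
    case 0
    show ?case by (auto intro!: continuous_intros)
  next
    case (Suc k)
    have "frechet_derivative (\<lambda>x. poly p (1 - x \<bullet> y)) (at x) b =
        poly (smult (- (b \<bullet> y)) (pderiv p)) (1 - x \<bullet> y)" for x b
      using frechet_derivative_at[OF has_derivative_poly_zonal[of p y x], symmetric] by (simp add: mult.commute)
    moreover have "(\<lambda>x. poly p (1 - x \<bullet> y)) differentiable at x" for x
      using has_derivative_poly_zonal differentiableI by blast
    ultimately show ?case by (simp only: Ck_on.simps Suc) simp
  qed
  then show ?thesis
    unfolding smooth_on_sphere_def by (intro exI[of _ UNIV] exI[of _ "\<lambda>x. poly p (1 - x \<bullet> y)"]) auto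
qed

section \<open>The volume of the sphere\<close>

lemma space_sphere_volume [simp]: "space (sphere_volume :: 'a::euclidean_space measure) = sphere 0 1"
  by (simp add: sphere_volume_def space_scale_measure space_restrict_space)

lemma sets_sphere_volume [measurable_cong]:
  "sets (sphere_volume :: 'a::euclidean_space measure) = sets (restrict_space borel (sphere 0 1))"
  by (simp add: sphere_volume_def sets_scale_measure)

lemma continuous_imp_measurable_sphere_volume:
  fixes f :: "'a::euclidean_space \<Rightarrow> real"
  assumes "continuous_on (sphere 0 1) f"
  shows "f \<in> borel_measurable sphere_volume"
  using borel_measurable_continuous_on_restrict[OF assms]
  unfolding measurable_cong_sets[OF sets_sphere_volume refl] .

lemma sgn_measurable_sphere:
  "sgn \<in> measurable (restrict_space lborel (ball 0 1 - {0 :: 'a::euclidean_space}))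
     (restrict_space borel (sphere 0 1))"
proof (rule measurable_restrict_space2)
  have "continuous_on (ball 0 1 - {0 :: 'a}) sgn"
    by (intro continuous_on_sgn continuous_on_id) auto
  then have "sgn \<in> borel_measurable (restrict_space borel (ball 0 1 - {0 :: 'a}))"
    by (rule borel_measurable_continuous_on_restrict)
  then show "sgn \<in> borel_measurable (restrict_space lborel (ball 0 1 - {0 :: 'a}))"
    by (subst measurable_cong_sets[of _ "restrict_space borel (ball 0 1 - {0})"])
      (auto simp: sets_restrict_space)
qed (auto simp: space_restrict_space norm_sgn)

lemma sphere_area_eq:
  "sphere_area TYPE('a::euclidean_space) = real DIM('a) * unit_ball_vol (real DIM('a))"
proof -
  let ?R = "restrict_space lborel (ball 0 1 - {0 :: 'a})"
  have "emeasure (sphere_volume :: 'a measure) (sphere 0 1) =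
      of_nat DIM('a) * emeasure ?R (sgn -` sphere 0 1 \<inter> space ?R)"
    unfolding sphere_volume_def emeasure_scale_measure
    by (subst emeasure_distr[OF sgn_measurable_sphere]) (auto simp: sets_restrict_space)
  also have "sgn -` sphere 0 1 \<inter> space ?R = ball 0 1 - {0}"
    by (auto simp: space_restrict_space norm_sgn)
  also have "emeasure ?R (ball 0 1 - {0}) = emeasure lborel (ball 0 1 - {0 :: 'a})"
    by (rule emeasure_restrict_space) auto
  also have "\<dots> = emeasure lborel (ball 0 1 :: 'a set)"
    by (subst emeasure_Diff_null_set) auto
  also have "\<dots> = ennreal (unit_ball_vol (real DIM('a)))"
    using emeasure_ball[of 1 "0 :: 'a"] by simp
  finally show ?thesis
    by (simp add: sphere_area_def measure_def ennreal_of_nat_eq_real_of_nat ennreal_mult[symmetric])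
qed

section \<open>The integral of the distance\<close>

text \<open>From u - u^2/2 <= sin u and the crude bound u <= 4 sin u one gets u^2/2 <= 8 sin^2
  u.\<close>

lemma le_sin_quadratic:
  fixes u :: real
  assumes u: "0 \<le> u" "u \<le> pi / 2"
  shows "u \<le> sin u + 8 * (sin u)\<^sup>2"
proof -
  have lower: "v - v\<^sup>2 / 2 \<le> sin v" if "0 \<le> v" for v :: real
  proof -
    have "sin 0 - 0 + 0\<^sup>2 / 2 \<le> sin v - v + v\<^sup>2 / 2"
    proof (rule DERIV_nonneg_imp_nondecreasing[OF that])
      fix w :: real assume w: "0 \<le> w" "w \<le> v"
      \<comment> \<open>These facts give 1 - cos w <= w, so the derivative of sin u - u + u^2/2 is
        nonnegative.\<close>
      have "cos w = 1 - 2 * (sin (w / 2))\<^sup>2" using cos_double_sin[of "w / 2"] by simp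
      moreover have "(sin (w / 2))\<^sup>2 \<le> \<bar>sin (w / 2)\<bar>"
        using mult_left_le[of "\<bar>sin (w / 2)\<bar>" "\<bar>sin (w / 2)\<bar>"] abs_sin_le_one[of "w / 2"]
        by (simp add: power2_eq_square)
      moreover have "\<bar>sin (w / 2)\<bar> \<le> w / 2" using abs_sin_x_le_abs_x[of "w / 2"] w by simp
      ultimately have "cos w - 1 + w \<ge> 0" by linarith
      moreover have "((\<lambda>u. sin u - u + u\<^sup>2 / 2) has_real_derivative (cos w - 1 + w)) (at w)"
        by (auto intro!: derivative_eq_intros)
      ultimately show "\<exists>y. ((\<lambda>u. sin u - u + u\<^sup>2 / 2) has_real_derivative y) (at w) \<and> 0 \<le> y"
        by blast
    qed
    then show ?thesis by simp
  qed
  have u4: "u \<le> 4 * sin u"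
  proof (cases "u \<le> 1")
    case True
    then have "u\<^sup>2 \<le> u" using u by (simp add: power2_eq_square mult_left_le)
    then show ?thesis using lower[of u] u by linarith
  next
    case False
    then have "sin 1 \<le> sin u" using u by (intro sin_monotone_2pi_le) (use pi_ge_two in auto)
    then show ?thesis using lower[of 1] u pi_less_4 by (simp add: power2_eq_square)
  qed
  then have "u\<^sup>2 \<le> (4 * sin u)\<^sup>2" using u by (intro power_mono) auto
  then show ?thesis using lower[of u] u by (simp add: power_mult_distrib)
qed

text \<open>With u half the angle, s = 2 sin^2 u, and sqrt(2 s) = 2 sin u is the chord length. Thus
  arc and chord are compared through u and sin u.\<close>

lemma arccos_one_minus_bounds:
  fixes s :: real
  assumes s: "s \<in> {0..2}"
  shows "sqrt 2 * sqrt s \<le> arccos (1 - s)" "arccos (1 - s) \<le> sqrt 2 * sqrt s + 8 * s"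
    "s \<le> sqrt 2 * sqrt s"
proof -
  define u where "u = arccos (1 - s) / 2"
  have u: "0 \<le> u" "u \<le> pi / 2"
    using s by (auto simp: u_def arccos_lbound arccos_ubound)
  have "1 - 2 * (sin u)\<^sup>2 = 1 - s"
    using s cos_double_sin[of u] by (simp add: u_def)
  then have sin: "s = 2 * (sin u)\<^sup>2" by simp
  have "sin u \<ge> 0" using u by (intro sin_ge_zero) auto
  then have root: "sqrt 2 * sqrt s = 2 * sin u" unfolding sin by (simp add: real_sqrt_mult)
  show "sqrt 2 * sqrt s \<le> arccos (1 - s)"
    using sin_x_le_x[OF u(1)] unfolding root by (simp add: u_def)
  show "arccos (1 - s) \<le> sqrt 2 * sqrt s + 8 * s"
  proof -
    have "arccos (1 - s) = 2 * u" by (simp add: u_def)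
    then show ?thesis using le_sin_quadratic[OF u] root sin by linarith
  qed
  show "s \<le> sqrt 2 * sqrt s"
    unfolding root unfolding sin using \<open>sin u \<ge> 0\<close> by (simp add: power2_eq_square mult_left_le)
qed

lemma continuous_on_arccos_one_minus: "continuous_on {0..2} (\<lambda>s::real. arccos (1 - s))"
  by (intro continuous_intros) auto

text \<open>By surjectivity \<open>repr\<close> fixes the functional on all polynomials, and these
  are dense in C[0,2]. This yields the independence of the pole y.\<close>

lemma zonal_functional_unique:
  assumes "zonal_functional \<epsilon> n C \<Phi>" "zonal_functional \<epsilon> n D \<Psi>" and f: "continuous_on {0..2} f"
  shows "\<Phi> f = \<Psi> f"
proof -
  interpret P: zonal_functional \<epsilon> n C \<Phi> by fact
  interpret Q: zonal_functional \<epsilon> n D \<Psi> by fact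
  have "\<bar>\<Phi> f - \<Psi> f\<bar> \<le> (C + D) * \<eta>" if \<eta>: "\<eta> > 0" for \<eta>
  proof -
    obtain q where q: "\<And>s. s \<in> {0..2} \<Longrightarrow> \<bar>f s - poly q s\<bar> < \<eta>"
      using weierstrass_poly[OF f \<eta>] by blast
    obtain p where p: "helmholtz_op \<epsilon> n p = q" using helmholtz_op_surj[OF P.n_pos] .
    have "\<Phi> (poly q) = \<Psi> (poly q)" using P.repr[of p] Q.repr[of p] p by simp
    moreover have "\<bar>\<Phi> f - \<Phi> (poly q)\<bar> \<le> C * \<eta>" "\<bar>\<Psi> f - \<Psi> (poly q)\<bar> \<le> D * \<eta>"
      by (rule P.dist_le[OF f] Q.dist_le[OF f]; use q in \<open>force intro: continuous_intros less_imp_le\<close>)+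
    ultimately show ?thesis by (simp add: distrib_right)
  qed
  then have "\<bar>\<Phi> f - \<Psi> f\<bar> \<le> 0"
    using nonpos_if_le_mult_pos[of "C + D" "\<bar>\<Phi> f - \<Psi> f\<bar>"] P.C_nonneg Q.C_nonneg by simp
  then show ?thesis by simp
qed

context zonal_functional
begin

text \<open>Positivity transfers the pointwise bounds. The error 8 s costs 8 times the first moment,
  which is at most n \<epsilon>^2; the same moment is positive and lies below the integral of the
  chord, so A is positive.\<close>

lemma arccos_bounds:
  defines "A \<equiv> \<Phi> (\<lambda>s. arccos (1 - s))"
  shows "sqrt 2 * \<Phi> sqrt \<le> A" "A \<le> sqrt 2 * \<Phi> sqrt + 8 * n * \<epsilon>\<^sup>2" "0 < A"
proof -
  have cont: "continuous_on {0..2} (\<lambda>s. sqrt 2 * sqrt s)" "continuous_on {0..2} sqrt"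
      "continuous_on {0..2} (\<lambda>s::real. s)" "continuous_on {0..2} (\<lambda>s. sqrt 2 * sqrt s + 8 * s)"
    by (intro continuous_intros)+
  have id: "\<Phi> (\<lambda>s. s) = moment 1"
    unfolding moment_def by (intro cong continuous_on_powr_const continuous_intros) auto
  have pos: "1 + \<epsilon>\<^sup>2 * n > 0" using n_pos by (intro add_pos_nonneg) auto
  have moment: "moment 1 = \<epsilon>\<^sup>2 * n / (1 + \<epsilon>\<^sup>2 * n)" using moment_one pos by (simp add: eq_divide_eq)
  have "\<epsilon>\<^sup>2 * n > 0" using n_pos eps_pos by simp
  have root: "\<Phi> (\<lambda>s. sqrt 2 * sqrt s) = sqrt 2 * \<Phi> sqrt" by (rule scale[OF cont(2)])
  show lower: "sqrt 2 * \<Phi> sqrt \<le> A"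
    unfolding A_def root[symmetric]
    by (intro mono cont continuous_on_arccos_one_minus arccos_one_minus_bounds)
  have "A \<le> \<Phi> (\<lambda>s. sqrt 2 * sqrt s + 8 * s)"
    unfolding A_def by (intro mono cont continuous_on_arccos_one_minus arccos_one_minus_bounds)
  also have "\<dots> = sqrt 2 * \<Phi> sqrt + 8 * moment 1"
    unfolding id[symmetric] by (rule lin[OF cont(2,3)])
  also have "moment 1 \<le> \<epsilon>\<^sup>2 * n"
    unfolding moment using \<open>\<epsilon>\<^sup>2 * n > 0\<close> by (simp add: divide_le_eq mult_nonneg_nonneg distrib_left)
  finally show "A \<le> sqrt 2 * \<Phi> sqrt + 8 * n * \<epsilon>\<^sup>2" by (simp add: mult_ac)
  have "0 < moment 1" unfolding moment using \<open>\<epsilon>\<^sup>2 * n > 0\<close> pos by simp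
  also have "moment 1 \<le> sqrt 2 * \<Phi> sqrt"
    unfolding id[symmetric] root[symmetric] by (intro mono cont arccos_one_minus_bounds)
  finally show "0 < A" using lower by simp
qed

end

text \<open>After division by \<epsilon> the chord and the arc differ by at most 8 n \<epsilon>, so
  the limits agree up to the factor sqrt 2, and 2 Gamma(3/2) = sqrt pi.\<close>

lemma arccos_functional_limit:
  fixes \<Phi> :: "real \<Rightarrow> (real \<Rightarrow> real) \<Rightarrow> real"
  assumes n: "n > 0" and zf: "\<And>\<epsilon>. \<epsilon> > 0 \<Longrightarrow> zonal_functional \<epsilon> n (C \<epsilon>) (\<Phi> \<epsilon>)"
  shows "((\<lambda>\<epsilon>. \<Phi> \<epsilon> (\<lambda>s. arccos (1 - s)) / \<epsilon>) \<longlongrightarrow>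
    sqrt pi * Gamma ((n + 1) / 2) / Gamma (n / 2)) (at_right 0)"
proof -
  have ev: "eventually (\<lambda>\<epsilon>::real. \<epsilon> > 0) (at_right 0)" by (simp add: eventually_at_right_less)
  have gamma: "Gamma (3 / 2 :: real) = sqrt pi / 2"
  proof -
    have "(1 / 2 :: real) \<notin> \<int>\<^sub>\<le>\<^sub>0" by (auto elim!: nonpos_Ints_cases)
    from Gamma_plus1[OF this] show ?thesis by (simp add: Gamma_one_half_real)
  qed
  have c: "sqrt 2 * (sqrt 2 * Gamma (3/2) * Gamma ((n + 1) / 2) / Gamma (n / 2)) =
      sqrt pi * Gamma ((n + 1) / 2) / Gamma (n / 2)"
  proof -
    have "sqrt 2 * (sqrt 2 * Gamma (3/2) * Gamma ((n + 1) / 2) / Gamma (n / 2)) =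
        (sqrt 2 * sqrt 2) * Gamma (3/2) * Gamma ((n + 1) / 2) / Gamma (n / 2)"
      by (simp only: times_divide_eq_right mult.assoc)
    also have "sqrt 2 * sqrt 2 = (2::real)" by simp
    also have "2 * Gamma (3/2 :: real) = sqrt pi" by (simp add: gamma)
    finally show ?thesis .
  qed
  have lower: "((\<lambda>\<epsilon>. sqrt 2 * (\<Phi> \<epsilon> sqrt / \<epsilon>)) \<longlongrightarrow> sqrt pi * Gamma ((n + 1) / 2) / Gamma (n / 2)) (at_right 0)"
    unfolding c[symmetric] by (intro tendsto_mult tendsto_const moment_half_limit[OF n zf])
  have "((\<lambda>\<epsilon>. 8 * n * \<epsilon>) \<longlongrightarrow> 8 * n * 0) (at_right 0)" by (intro tendsto_intros)
  then have upper: "((\<lambda>\<epsilon>. sqrt 2 * (\<Phi> \<epsilon> sqrt / \<epsilon>) + 8 * n * \<epsilon>) \<longlongrightarrow>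
      sqrt pi * Gamma ((n + 1) / 2) / Gamma (n / 2)) (at_right 0)"
    using tendsto_add[OF lower] by fastforce
  show ?thesis
  proof (rule tendsto_sandwich[OF _ _ lower upper])
    show "\<forall>\<^sub>F \<epsilon> in at_right 0. sqrt 2 * (\<Phi> \<epsilon> sqrt / \<epsilon>) \<le> \<Phi> \<epsilon> (\<lambda>s. arccos (1 - s)) / \<epsilon>"
      using ev by eventually_elim
        (use zonal_functional.arccos_bounds(1)[OF zf] in \<open>simp add: divide_right_mono\<close>)
    show "\<forall>\<^sub>F \<epsilon> in at_right 0. \<Phi> \<epsilon> (\<lambda>s. arccos (1 - s)) / \<epsilon> \<le> sqrt 2 * (\<Phi> \<epsilon> sqrt / \<epsilon>) + 8 * n * \<epsilon>"
      using ev
    proof eventually_elim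
      case (elim \<epsilon>)
      have "\<Phi> \<epsilon> (\<lambda>s. arccos (1 - s)) / \<epsilon> \<le> (sqrt 2 * \<Phi> \<epsilon> sqrt + 8 * n * \<epsilon>\<^sup>2) / \<epsilon>"
        using zonal_functional.arccos_bounds(2)[OF zf[OF elim]] elim by (intro divide_right_mono) auto
      also have "\<dots> = sqrt 2 * (\<Phi> \<epsilon> sqrt / \<epsilon>) + 8 * n * \<epsilon>"
        using elim by (simp add: add_divide_distrib power2_eq_square)
      finally show ?case .
    qed
  qed
qed

section \<open>From Helmholtz kernels to zonal functionals\<close>

lemma zonal_functional_helmholtz_kernel:
  fixes K :: "'a::euclidean_space \<Rightarrow> 'a \<Rightarrow> real"
  assumes "\<epsilon> > 0" and K: "helmholtz_kernel \<epsilon> K" and y: "y \<in> sphere 0 1" and dim: "DIM('a) \<ge> 2"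
  shows "zonal_functional \<epsilon> (real DIM('a) - 1) (\<integral>x. \<bar>K x y\<bar> \<partial>sphere_volume)
    (\<lambda>q. \<integral>x. K x y * q (1 - x \<bullet> y) \<partial>sphere_volume)"
proof
  have int: "integrable sphere_volume (\<lambda>x. K x y)"
    using K y by (simp add: helmholtz_kernel_def)
  have range: "1 - x \<bullet> y \<in> {0..2}" if "x \<in> sphere 0 1" for x
    using Cauchy_Schwarz_ineq2[of x y] that y by auto
  have intq: "integrable sphere_volume (\<lambda>x. K x y * q (1 - x \<bullet> y))" if q: "continuous_on {0..2} q" for q
  proof -
    have "bounded (q ` {0..2})" by (intro compact_imp_bounded compact_continuous_image q) simp
    then obtain B where "\<forall>s\<in>{0..2}. \<bar>q s\<bar> \<le> B" by (auto simp: bounded_iff)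
    then have B: "\<And>s. s \<in> {0..2} \<Longrightarrow> \<bar>q s\<bar> \<le> B" by blast
    have "continuous_on (sphere 0 1) (\<lambda>x. q (1 - x \<bullet> y))"
      by (rule continuous_on_compose2[OF q]) (use range in \<open>auto intro!: continuous_intros\<close>)
    then have meas: "(\<lambda>x. q (1 - x \<bullet> y)) \<in> borel_measurable sphere_volume"
      by (rule continuous_imp_measurable_sphere_volume)
    show ?thesis
    proof (rule Bochner_Integration.integrable_bound)
      show "integrable sphere_volume (\<lambda>x. B * K x y)" using int by simp
      show "(\<lambda>x. K x y * q (1 - x \<bullet> y)) \<in> borel_measurable sphere_volume"
        using borel_measurable_integrable[OF int] meas by (rule borel_measurable_times)
      have "\<bar>K x y * q (1 - x \<bullet> y)\<bar> \<le> \<bar>B * K x y\<bar>" if "x \<in> sphere 0 1" for x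
      proof -
        have "\<bar>q (1 - x \<bullet> y)\<bar> \<le> \<bar>B\<bar>" using B[OF range[OF that]] by linarith
        from mult_left_mono[OF this, of "\<bar>K x y\<bar>"] show ?thesis by (simp add: abs_mult mult.commute)
      qed
      then show "AE x in sphere_volume. norm (K x y * q (1 - x \<bullet> y)) \<le> norm (B * K x y)"
        by (intro AE_I2) simp
    qed
  qed
  show "\<epsilon> > 0" "real DIM('a) - 1 > 0" using assms by auto
  show "0 \<le> (\<integral>x. \<bar>K x y\<bar> \<partial>sphere_volume)" by simp
  show "(\<integral>x. K x y * (a * f (1 - x \<bullet> y) + b * g (1 - x \<bullet> y)) \<partial>sphere_volume) =
      a * (\<integral>x. K x y * f (1 - x \<bullet> y) \<partial>sphere_volume) + b * (\<integral>x. K x y * g (1 - x \<bullet> y) \<partial>sphere_volume)"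
    if "continuous_on {0..2} f" "continuous_on {0..2} g" for f g a b
  proof -
    have "(\<integral>x. K x y * (a * f (1 - x \<bullet> y) + b * g (1 - x \<bullet> y)) \<partial>sphere_volume) =
        (\<integral>x. a * (K x y * f (1 - x \<bullet> y)) + b * (K x y * g (1 - x \<bullet> y)) \<partial>sphere_volume)"
      by (simp add: algebra_simps)
    also have "\<dots> = (\<integral>x. a * (K x y * f (1 - x \<bullet> y)) \<partial>sphere_volume) + (\<integral>x. b * (K x y * g (1 - x \<bullet> y)) \<partial>sphere_volume)"
      using that by (intro Bochner_Integration.integral_add integrable_mult_right intq)
    finally show ?thesis by simp
  qed
  show "\<bar>\<integral>x. K x y * f (1 - x \<bullet> y) \<partial>sphere_volume\<bar> \<le> (\<integral>x. \<bar>K x y\<bar> \<partial>sphere_volume) * B"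
    if f: "continuous_on {0..2} f" and B: "\<And>s. s \<in> {0..2} \<Longrightarrow> \<bar>f s\<bar> \<le> B" for f B
  proof -
    have "\<bar>\<integral>x. K x y * f (1 - x \<bullet> y) \<partial>sphere_volume\<bar> \<le> (\<integral>x. \<bar>K x y * f (1 - x \<bullet> y)\<bar> \<partial>sphere_volume)"
      by (rule integral_abs_bound)
    also have "\<dots> \<le> (\<integral>x. \<bar>K x y\<bar> * B \<partial>sphere_volume)"
    proof (rule integral_mono)
      show "integrable sphere_volume (\<lambda>x. \<bar>K x y * f (1 - x \<bullet> y)\<bar>)"
        by (rule integrable_abs[OF intq[OF f]])
      show "integrable sphere_volume (\<lambda>x. \<bar>K x y\<bar> * B)" using int by simp
    qed (use B[OF range] in \<open>simp add: abs_mult mult_left_mono\<close>)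
    also have "\<dots> = (\<integral>x. \<bar>K x y\<bar> \<partial>sphere_volume) * B" by simp
    finally show ?thesis .
  qed
  show "(\<integral>x. K x y * poly (helmholtz_op \<epsilon> (real DIM('a) - 1) p) (1 - x \<bullet> y) \<partial>sphere_volume) = poly p 0" for p
  proof -
    have "(\<integral>x. K x y * poly (helmholtz_op \<epsilon> (real DIM('a) - 1) p) (1 - x \<bullet> y) \<partial>sphere_volume) =
      (\<integral>x. K x y * (poly p (1 - x \<bullet> y) - \<epsilon>\<^sup>2 * sphere_laplacian (\<lambda>x. poly p (1 - x \<bullet> y)) x) \<partial>sphere_volume)"
      using y by (intro Bochner_Integration.integral_cong)
        (auto simp: poly_helmholtz_op sphere_laplacian_poly_zonal)
    \<comment> \<open>The zonal polynomial serves as test function; its value at the pole is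
      p(0).\<close>
    also have "\<dots> = poly p (1 - y \<bullet> y)"
      using K y smooth_on_sphere_poly_zonal[of p y] unfolding helmholtz_kernel_def by blast
    finally show ?thesis using y by (simp add: dot_square_norm)
  qed
qed

section \<open>The constant k_n in terms of Gamma values\<close>

lemma sphere_area_ratio:
  assumes "n \<ge> 2" "DIM('b::euclidean_space) = n" "DIM('c::euclidean_space) = n - 1"
  shows "2 / (real n - 1) * (sphere_area TYPE('c) / sphere_area TYPE('b)) *
    (sqrt pi * Gamma ((real n + 1) / 2) / Gamma (real n / 2)) = 1"
proof -
  define P G0 G1 where "P = pi powr ((real n - 1) / 2)" "G0 = Gamma (real n / 2)" "G1 = Gamma ((real n + 1) / 2)"
  have pos: "P > 0" "G0 > 0" "G1 > 0" "real n - 1 > 0"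
    using assms(1) by (auto simp: P_G0_G1_def)
  have "real n / 2 \<notin> \<int>\<^sub>\<le>\<^sub>0" using assms(1) by (auto elim!: nonpos_Ints_cases)
  then have "Gamma (real n / 2 + 1) = real n / 2 * G0"
    unfolding P_G0_G1_def by (rule Gamma_plus1)
  \<comment> \<open>The ball volumes in dimensions n and n - 1 are expressed by the common power P
    of pi, which cancels in the ratio of areas and leaves the factor sqrt pi.\<close>
  moreover have "pi powr (real n / 2) = P * sqrt pi"
    unfolding P_G0_G1_def by (simp add: powr_half_sqrt[symmetric] powr_add[symmetric] field_simps)
  ultimately have b: "sphere_area TYPE('b) = real n * (P * sqrt pi / (real n / 2 * G0))"
    by (simp only: sphere_area_eq unit_ball_vol_def assms(2))
  have "(real n - 1) / 2 + 1 = (real n + 1) / 2" by (simp add: field_simps)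
  moreover have "real DIM('c) = real n - 1" using assms(1,3) by simp
  ultimately have c: "sphere_area TYPE('c) = (real n - 1) * (P / G1)"
    by (simp only: sphere_area_eq unit_ball_vol_def P_G0_G1_def)
  show ?thesis
    unfolding b c P_G0_G1_def(2,3)[symmetric] using pos by (simp add: divide_simps)
qed

theorem proposition5p3:
  fixes n :: nat
    and K :: "real \<Rightarrow> 'a::euclidean_space \<Rightarrow> 'a \<Rightarrow> real"
    and k\<^sub>n :: real
    and \<gamma> :: "real \<Rightarrow> 'a \<Rightarrow> real"
  assumes "n \<ge> 2"
    and "DIM('a) = n + 1"
    and "DIM('b::euclidean_space) = n"
    and "DIM('c::euclidean_space) = n - 1"
    and "k\<^sub>n = 2 / (real n - 1) * (sphere_area TYPE('c) / sphere_area TYPE('b))"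
    and "\<And>\<epsilon>. \<epsilon> > 0 \<Longrightarrow> helmholtz_kernel \<epsilon> (K \<epsilon>)"
    and "\<And>\<epsilon> y. \<epsilon> > 0 \<Longrightarrow> y \<in> sphere 0 1 \<Longrightarrow>
           1 / \<gamma> \<epsilon> y = k\<^sub>n * (\<integral>x. geodesic_dist x y / \<epsilon> * K \<epsilon> x y \<partial>sphere_volume)"
  shows "(\<forall>\<epsilon>>0. \<forall>y\<in>sphere 0 1. \<gamma> \<epsilon> y \<noteq> 0)
       \<and> (\<forall>\<epsilon>>0. \<forall>y\<in>sphere 0 1. \<forall>y'\<in>sphere 0 1. \<gamma> \<epsilon> y = \<gamma> \<epsilon> y')
       \<and> (\<exists>\<gamma>\<^sub>c\<^sub>r\<^sub>i\<^sub>t>0. (\<forall>y\<in>sphere 0 1. ((\<lambda>\<epsilon>. \<gamma> \<epsilon> y) \<longlongrightarrow> \<gamma>\<^sub>c\<^sub>r\<^sub>i\<^sub>t) (at_right 0)) \<and> \<gamma>\<^sub>c\<^sub>r\<^sub>i\<^sub>t = 1)"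
proof -
  define \<Phi> where "\<Phi> \<epsilon> y q = (\<integral>x. K \<epsilon> x y * q (1 - x \<bullet> y) \<partial>sphere_volume)" for \<epsilon> y and q :: "real \<Rightarrow> real"
  define A where "A \<epsilon> y = \<Phi> \<epsilon> y (\<lambda>s. arccos (1 - s))" for \<epsilon> y
  have zf: "zonal_functional \<epsilon> (real n) (\<integral>x. \<bar>K \<epsilon> x y\<bar> \<partial>sphere_volume) (\<Phi> \<epsilon> y)"
    if "\<epsilon> > 0" "y \<in> sphere 0 1" for \<epsilon> y
    using zonal_functional_helmholtz_kernel[OF that(1) assms(6)[OF that(1)] that(2)] assms(1,2)
    by (simp add: \<Phi>_def[abs_def])
  have inv: "1 / \<gamma> \<epsilon> y = k\<^sub>n * (A \<epsilon> y / \<epsilon>)" if "\<epsilon> > 0" "y \<in> sphere 0 1" for \<epsilon> y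
  proof -
    have "(\<integral>x. geodesic_dist x y / \<epsilon> * K \<epsilon> x y \<partial>sphere_volume) =
        (\<integral>x. K \<epsilon> x y * arccos (1 - (1 - x \<bullet> y)) / \<epsilon> \<partial>sphere_volume)"
      using that assms(1,2)
      by (intro Bochner_Integration.integral_cong) (auto simp: geodesic_dist_eq_arccos)
    also have "\<dots> = A \<epsilon> y / \<epsilon>" by (simp add: A_def \<Phi>_def)
    finally show ?thesis using assms(7)[OF that] by (simp only:)
  qed
  have kn: "k\<^sub>n * (sqrt pi * Gamma ((real n + 1) / 2) / Gamma (real n / 2)) = 1"
    unfolding assms(5) by (rule sphere_area_ratio) (use assms in auto)
  then have "k\<^sub>n \<noteq> 0" by auto
  \<comment> \<open>Since \<open>1 / 0 = 0\<close>, a zero of \<gamma> would make the right-hand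
    side of \<open>inv\<close> vanish, against the positivity of A.\<close>
  have nonzero: "\<gamma> \<epsilon> y \<noteq> 0" if "\<epsilon> > 0" "y \<in> sphere 0 1" for \<epsilon> y
    using inv[OF that] zonal_functional.arccos_bounds(3)[OF zf[OF that]] \<open>k\<^sub>n \<noteq> 0\<close> that(1)
    by (auto simp: A_def)
  have indep: "\<gamma> \<epsilon> y = \<gamma> \<epsilon> y'" if "\<epsilon> > 0" "y \<in> sphere 0 1" "y' \<in> sphere 0 1" for \<epsilon> y y'
  proof -
    have "A \<epsilon> y = A \<epsilon> y'"
      unfolding A_def using zonal_functional_unique[OF zf zf continuous_on_arccos_one_minus] that by blast
    then have "1 / \<gamma> \<epsilon> y = 1 / \<gamma> \<epsilon> y'" using inv that by simp
    then show ?thesis by simp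
  qed
  have lim: "((\<lambda>\<epsilon>. \<gamma> \<epsilon> y) \<longlongrightarrow> 1) (at_right 0)" if y: "y \<in> sphere 0 1" for y
  proof -
    have "((\<lambda>\<epsilon>. k\<^sub>n * (A \<epsilon> y / \<epsilon>)) \<longlongrightarrow>
        k\<^sub>n * (sqrt pi * Gamma ((real n + 1) / 2) / Gamma (real n / 2))) (at_right 0)"
      unfolding A_def using assms(1) zf[OF _ y]
      by (intro tendsto_mult tendsto_const arccos_functional_limit) auto
    \<comment> \<open>The limit of 1 / \<gamma> is 1 by \<open>kn\<close>, so inversion is
      continuous there.\<close>
    then have "((\<lambda>\<epsilon>. inverse (k\<^sub>n * (A \<epsilon> y / \<epsilon>))) \<longlongrightarrow> inverse 1) (at_right 0)"
      unfolding kn by (rule tendsto_inverse) simp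
    moreover have "eventually (\<lambda>\<epsilon>. inverse (k\<^sub>n * (A \<epsilon> y / \<epsilon>)) = \<gamma> \<epsilon> y) (at_right 0)"
      using eventually_at_right_less[of "0::real"]
    proof eventually_elim
      case (elim \<epsilon>)
      show ?case by (simp only: inv[OF elim y, symmetric] inverse_eq_divide) simp
    qed
    ultimately have "((\<lambda>\<epsilon>. \<gamma> \<epsilon> y) \<longlongrightarrow> inverse 1) (at_right 0)"
      by (rule Lim_transform_eventually)
    then show ?thesis by simp
  qed
  show ?thesis
    by (intro conjI exI[of _ 1]) (use nonzero indep lim zero_less_one in blast)+
qed

end
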